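(* Let $\mathfrak{A}$ be a unital AF algebra with unit $1_{\mathfrak{A}}$ endowed with a faithful tracial state $\mu$. Let $\mathcal{U}=(\mathfrak{A}_n)_{n\in\mathbb{N}}$ be an increasing sequence of unital finite dimensional C*-subalgebras such that $\mathfrak{A}=\overline{\cup_{n\in\mathbb{N}}\mathfrak{A}_n}^{\|\cdot\|_{\mathfrak{A}}}$ with $\mathfrak{A}_0=\mathbb{C}1_{\mathfrak{A}}$. Let $\mathfrak{B}$ be a unital AF algebra with unit $1_{\mathfrak{B}}$ endowed with a faithful tracial state $\nu$, and let $\mathcal{V}=(\mathfrak{B}_n)_{n\in\mathbb{N}}$ be an increasing sequence of unital finite dimensional C*-subalgebras such that $\mathfrak{B}=\overline{\cup_{n\in\mathbb{N}}\mathfrak{B}_n}^{\|\cdot\|_{\mathfrak{B}}}$ with $\mathfrak{B}_0=\mathbb{C}1_{\mathfrak{B}}$. Let $\beta:\mathbb{N}\to(0,\infty)$ have limit $0$ at infinity. Let $\mathsf{L}^\beta_{\mathcal{U},\mu}$, $\mathsf{L}^\beta_{\mathcal{V},\nu}$ denote the associated $(2,0)$-quasi-Leibniz Lip-norms on $\mathfrak{A}$, $\mathfrak{B}$ respectively. If $\phi:\mathfrak{A}\hookrightarrow\mathfrak{B}$ is a unital *-monomorphism such that (1) $\phi(\mathfrak{A}_n)=\mathfrak{B}_n$ for all $n\in\mathbb{N}$, and (2) $\mu=\nu\circ\phi$, then $\phi:(\mathfrak{A},\mathsf{L}^\beta_{\mathcal{U},\mu})\to(\mathfrak{B},\mathsf{L}^\beta_{\mathcal{V},\nu})$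 is a quantum isometry and $$\mathsf{\Lambda}_{2,0}\left((\mathfrak{A},\mathsf{L}^\beta_{\mathcal{U},\mu}),(\mathfrak{B},\mathsf{L}^\beta_{\mathcal{V},\nu})\right)=0.$$ Moreover, for all $n\in\mathbb{N}$, $$\mathsf{\Lambda}_{2,0}\left((\mathfrak{A}_n,\mathsf{L}^\beta_{\mathcal{U},\mu}),(\mathfrak{B}_n,\mathsf{L}^\beta_{\mathcal{V},\nu})\right)=0.$$
   Context: **The Lip-norms.** Given $\mathfrak{A},\mu,\mathcal{U},\beta$ as in the claim, let $\mathbb{E}(\cdot|\mathfrak{A}_n):\mathfrak{A}\to\mathfrak{A}_n$ be the unique conditional expectation onto $\mathfrak{A}_n$ with $\mu\circ\mathbb{E}(\cdot|\mathfrak{A}_n)=\mu$. For $a\in\mathfrak{sa}(\mathfrak{A})$, $$\mathsf{L}^\beta_{\mathcal{U},\mu}(a)=\sup\left\{\frac{\|a-\mathbb{E}(a|\mathfrak{A}_n)\|_{\mathfrak{A}}}{\beta(n)}:n\in\mathbb{N}\right\}\in[0,\infty],$$ and similarly $\mathsf{L}^\beta_{\mathcal{V},\nu}$ on $\mathfrak{sa}(\mathfrak{B})$. It is known that $(\mathfrak{A},\mathsf{L}^\beta_{\mathcal{U},\mu})$ and $(\mathfrak{A}_n,\mathsf{L}^\beta_{\mathcal{U},\mu})$ (restricted to $\mathfrak{sa}(\mathfrak{A}_n)$) are $(2,0)$-quasi-Leibniz quantum compact metric spaces. The subalgebras $\mathfrak{A}_n$ (resp. $\mathfrak{B}_n$)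 contain $1_{\mathfrak{A}}$ (resp. $1_{\mathfrak{B}}$). A quantum isometry $(\mathfrak{A},\mathsf{L}_{\mathfrak{A}})\to(\mathfrak{B},\mathsf{L}_{\mathfrak{B}})$ is a *-isomorphism $\pi:\mathfrak{A}\to\mathfrak{B}$ with $\mathsf{L}_{\mathfrak{B}}\circ\pi=\mathsf{L}_{\mathfrak{A}}$. **Quantum compact metric spaces.** For a unital C*-algebra $\mathfrak{A}$: $1_{\mathfrak{A}}$ is its unit, $\mathfrak{sa}(\mathfrak{A})$ its self-adjoint part, $\mathscr{S}(\mathfrak{A})$ its state space. For $C\geq1$, $D\geq0$, a $(C,D)$-quasi-Leibniz quantum compact metric space $(\mathfrak{A},\mathsf{L})$ is a unital C*-algebra $\mathfrak{A}$ with a seminorm $\mathsf{L}:\mathfrak{sa}(\mathfrak{A})\to[0,\infty]$ such that $\mathrm{dom}(\mathsf{L})=\{a\in\mathfrak{sa}(\mathfrak{A}):\mathsf{L}(a)<\infty\}$ is a dense unital Jordan-Lie subalgebra of $\mathfrak{sa}(\mathfrak{A})$ and: (i) $\{a:\mathsf{L}(a)=0\}=\mathbb{R}1_{\mathfrak{A}}$; (ii) for all $a,b\in\mathrm{dom}(\mathsf{L})$, $\max\{\mathsf{L}(\frac{ab+ba}{2}),\mathsf{L}(\frac{ab-ba}{2i})\}\leq C(\|a\|\mathsf{L}(b)+\|b\|\mathsf{L}(a))+D\mathsf{L}(a)\mathsf{L}(b)$; (iii) the metric $\mathsf{mk}_{\mathsf{L}}(\varphi,\psi)=\sup\{|\varphi(a)-\psi(a)|:a\in\mathrm{dom}(\mathsf{L}),\mathsf{L}(a)\leq1\}$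 metrizes the weak* topology of $\mathscr{S}(\mathfrak{A})$; (iv) $\mathsf{L}$ is lower semi-continuous for $\|\cdot\|_{\mathfrak{A}}$. **Quantum propinquity.** A bridge $\gamma=(\mathfrak{D},\pi_{\mathfrak{A}},\pi_{\mathfrak{B}},\omega)$ from $\mathfrak{A}$ to $\mathfrak{B}$ consists of a unital C*-algebra $\mathfrak{D}$, unital *-monomorphisms $\pi_{\mathfrak{A}}:\mathfrak{A}\to\mathfrak{D}$, $\pi_{\mathfrak{B}}:\mathfrak{B}\to\mathfrak{D}$ and $\omega\in\mathfrak{D}$ such that $\mathscr{S}_1(\mathfrak{D}|\omega)=\{\varphi\in\mathscr{S}(\mathfrak{D}):\varphi(1-\omega^*\omega)=\varphi(1-\omega\omega^* )=0\}\neq\emptyset$. Its height is the maximum of the Hausdorff distances, for $\mathsf{mk}_{\mathsf{L}_{\mathfrak{A}}}$ and $\mathsf{mk}_{\mathsf{L}_{\mathfrak{B}}}$ respectively, between $\mathscr{S}(\mathfrak{A})$ and $\{\varphi\circ\pi_{\mathfrak{A}}:\varphi\in\mathscr{S}_1(\mathfrak{D}|\omega)\}$, and between $\mathscr{S}(\mathfrak{B})$ and $\{\varphi\circ\pi_{\mathfrak{B}}:\varphi\in\mathscr{S}_1(\mathfrak{D}|\omega)\}$. Its reach is the Hausdorff distance between $\{a\in\mathfrak{sa}(\mathfrak{A}):\mathsf{L}_{\mathfrak{A}}(a)\leq1\}$ and $\{b\in\mathfrak{sa}(\mathfrak{B}):\mathsf{L}_{\mathfrak{B}}(b)\leq1\}$,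 where the distance from $a$ to $b$ is $\|\pi_{\mathfrak{A}}(a)\omega-\omega\pi_{\mathfrak{B}}(b)\|_{\mathfrak{D}}$. Its length is the maximum of height and reach. The quantum propinquity $\mathsf{\Lambda}_{C,D}$ is the largest $[0,\infty)$-valued function on pairs of $(C,D)$-quasi-Leibniz quantum compact metric spaces that is symmetric, satisfies the triangle inequality, and is at most the length of $\gamma$ for every bridge $\gamma$ between the two spaces (equivalently, the infimum, over finite chains of such spaces joined by bridges, of the sum of the lengths of the bridges). It is known to be zero exactly when there is a quantum isometry between the two spaces. *)

theory Defs
  imports "HOL-Analysis.Analysis" "HOL-Algebra.Algebra" "HOL-Algebra.Algebraic_Closure_Type"
begin

section \<open>Unital C*-algebras\<close>

record 'a cstar_algebra = "(complex, 'a) module" +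
  star :: "'a \<Rightarrow> 'a"
  nrm :: "'a \<Rightarrow> real"

text \<open>The value off the carrier is chosen such that \<^const>\<open>Metric_space\<close> applies, whose
  nonnegativity and symmetry axioms range over the whole type.\<close>

definition nrm_dist :: "'a cstar_algebra \<Rightarrow> 'a \<Rightarrow> 'a \<Rightarrow> real" where
  "nrm_dist A x y =
     (if x \<in> carrier A \<and> y \<in> carrier A then nrm A (x \<ominus>\<^bsub>A\<^esub> y) else 0)"

definition nrm_topology :: "'a cstar_algebra \<Rightarrow> 'a topology" where
  "nrm_topology A = Metric_space.mtopology (carrier A) (nrm_dist A)"

locale unital_cstar_algebra =
  ring A + scalars: module "ring_of_type_algebra :: complex ring" A
  for A :: "'a cstar_algebra" (structure) +
  assumes smult_mult_left:
      "\<lbrakk>x \<in> carrier A; y \<in> carrier A\<rbrakk> \<Longrightarrow> (c \<odot> x) \<otimes> y = c \<odot> (x \<otimes> y)"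
    and smult_mult_right:
      "\<lbrakk>x \<in> carrier A; y \<in> carrier A\<rbrakk> \<Longrightarrow> x \<otimes> (c \<odot> y) = c \<odot> (x \<otimes> y)"
    and star_closed: "x \<in> carrier A \<Longrightarrow> star A x \<in> carrier A"
    and star_star: "x \<in> carrier A \<Longrightarrow> star A (star A x) = x"
    and star_add:
      "\<lbrakk>x \<in> carrier A; y \<in> carrier A\<rbrakk> \<Longrightarrow> star A (x \<oplus> y) = star A x \<oplus> star A y"
    and star_smult: "x \<in> carrier A \<Longrightarrow> star A (c \<odot> x) = cnj c \<odot> star A x"
    and star_mult:
      "\<lbrakk>x \<in> carrier A; y \<in> carrier A\<rbrakk> \<Longrightarrow> star A (x \<otimes> y) = star A y \<otimes> star A x"
    and nrm_nonneg: "x \<in> carrier A \<Longrightarrow> 0 \<le> nrm A x"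
    and nrm_eq_zero_iff: "x \<in> carrier A \<Longrightarrow> nrm A x = 0 \<longleftrightarrow> x = \<zero>"
    and nrm_smult: "x \<in> carrier A \<Longrightarrow> nrm A (c \<odot> x) = cmod c * nrm A x"
    and nrm_add:
      "\<lbrakk>x \<in> carrier A; y \<in> carrier A\<rbrakk> \<Longrightarrow> nrm A (x \<oplus> y) \<le> nrm A x + nrm A y"
    and nrm_mult:
      "\<lbrakk>x \<in> carrier A; y \<in> carrier A\<rbrakk> \<Longrightarrow> nrm A (x \<otimes> y) \<le> nrm A x * nrm A y"
    and nrm_star_mult: "x \<in> carrier A \<Longrightarrow> nrm A (star A x \<otimes> x) = (nrm A x)\<^sup>2"
    and nrm_complete: "Metric_space.mcomplete (carrier A) (nrm_dist A)"

definition self_adjoint :: "'a cstar_algebra \<Rightarrow> 'a set" where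
  "self_adjoint A = {a \<in> carrier A. star A a = a}"

definition positive_elements :: "'a cstar_algebra \<Rightarrow> 'a set" where
  "positive_elements A = (\<lambda>x. star A x \<otimes>\<^bsub>A\<^esub> x) ` carrier A"

definition real_scalars :: "'a cstar_algebra \<Rightarrow> 'a set" where
  "real_scalars A = range (\<lambda>t::real. complex_of_real t \<odot>\<^bsub>A\<^esub> \<one>\<^bsub>A\<^esub>)"

definition complex_scalars :: "'a cstar_algebra \<Rightarrow> 'a set" where
  "complex_scalars A = range (\<lambda>c. c \<odot>\<^bsub>A\<^esub> \<one>\<^bsub>A\<^esub>)"

text \<open>A C*-subalgebra is the same structure with a smaller carrier. Since the unit is inherited,
  it contains the unit of the ambient algebra; completeness makes it norm closed.\<close>

definition unital_cstar_subalgebra :: "'a set \<Rightarrow> 'a cstar_algebra \<Rightarrow> bool" where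
  "unital_cstar_subalgebra S A \<longleftrightarrow>
     S \<subseteq> carrier A \<and> unital_cstar_algebra (A\<lparr>carrier := S\<rparr>)"

definition finite_dimensional :: "'a cstar_algebra \<Rightarrow> bool" where
  "finite_dimensional A \<longleftrightarrow>
     (\<exists>F. finite F \<and> F \<subseteq> carrier A \<and>
          (\<forall>x\<in>carrier A. \<exists>c. x = (\<Oplus>\<^bsub>A\<^esub>b\<in>F. c b \<odot>\<^bsub>A\<^esub> b)))"

text \<open>A unital C*-algebra with an increasing sequence of unital finite dimensional C*-subalgebras
  whose union is dense; in particular the algebra is AF.\<close>

definition AF_sequence :: "'a cstar_algebra \<Rightarrow> (nat \<Rightarrow> 'a set) \<Rightarrow> bool" where
  "AF_sequence A U \<longleftrightarrow>
     unital_cstar_algebra A \<and>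
     (\<forall>n. unital_cstar_subalgebra (U n) A \<and> finite_dimensional (A\<lparr>carrier := U n\<rparr>)) \<and>
     incseq U \<and>
     Abstract_Topology.closure_of (nrm_topology A) (\<Union>n. U n) = carrier A"

section \<open>Morphisms, states and conditional expectations\<close>

definition linear_on :: "'a cstar_algebra \<Rightarrow> 'b cstar_algebra \<Rightarrow> ('a \<Rightarrow> 'b) \<Rightarrow> bool" where
  "linear_on A B f \<longleftrightarrow>
     f \<in> carrier A \<rightarrow> carrier B \<and>
     (\<forall>x\<in>carrier A. \<forall>y\<in>carrier A. f (x \<oplus>\<^bsub>A\<^esub> y) = f x \<oplus>\<^bsub>B\<^esub> f y) \<and>
     (\<forall>c. \<forall>x\<in>carrier A. f (c \<odot>\<^bsub>A\<^esub> x) = c \<odot>\<^bsub>B\<^esub> f x)"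

text \<open>The maps in \<^const>\<open>ring_hom\<close> preserve the unit.\<close>

definition unital_star_hom :: "'a cstar_algebra \<Rightarrow> 'b cstar_algebra \<Rightarrow> ('a \<Rightarrow> 'b) \<Rightarrow> bool" where
  "unital_star_hom A B f \<longleftrightarrow>
     f \<in> ring_hom A B \<and> linear_on A B f \<and> (\<forall>x\<in>carrier A. f (star A x) = star B (f x))"

definition unital_star_mono :: "'a cstar_algebra \<Rightarrow> 'b cstar_algebra \<Rightarrow> ('a \<Rightarrow> 'b) \<Rightarrow> bool" where
  "unital_star_mono A B f \<longleftrightarrow> unital_star_hom A B f \<and> inj_on f (carrier A)"

definition star_iso :: "'a cstar_algebra \<Rightarrow> 'b cstar_algebra \<Rightarrow> ('a \<Rightarrow> 'b) \<Rightarrow> bool" where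
  "star_iso A B f \<longleftrightarrow> unital_star_hom A B f \<and> bij_betw f (carrier A) (carrier B)"

text \<open>States are the positive linear functionals of norm one; the norm of a positive functional
  is its value at the unit. Functionals are extended by \<^const>\<open>undefined\<close> outside the carrier, so
  that equality of states is equality on the algebra.\<close>

definition states :: "'a cstar_algebra \<Rightarrow> ('a \<Rightarrow> complex) set" where
  "states A = {\<phi> \<in> extensional (carrier A).
     (\<forall>x\<in>carrier A. \<forall>y\<in>carrier A. \<phi> (x \<oplus>\<^bsub>A\<^esub> y) = \<phi> x + \<phi> y) \<and>
     (\<forall>c. \<forall>x\<in>carrier A. \<phi> (c \<odot>\<^bsub>A\<^esub> x) = c * \<phi> x) \<and>
     (\<forall>x\<in>positive_elements A. \<phi> x \<in> \<real> \<and> 0 \<le> Re (\<phi> x)) \<and>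
     (\<forall>x\<in>carrier A. cmod (\<phi> x) \<le> nrm A x) \<and>
     \<phi> \<one>\<^bsub>A\<^esub> = 1}"

definition weak_star_topology :: "'a cstar_algebra \<Rightarrow> ('a \<Rightarrow> complex) topology" where
  "weak_star_topology A =
     subtopology (product_topology (\<lambda>_. euclidean) (carrier A)) (states A)"

definition faithful_tracial_state :: "'a cstar_algebra \<Rightarrow> ('a \<Rightarrow> complex) \<Rightarrow> bool" where
  "faithful_tracial_state A \<mu> \<longleftrightarrow>
     \<mu> \<in> states A \<and>
     (\<forall>x\<in>carrier A. \<forall>y\<in>carrier A. \<mu> (x \<otimes>\<^bsub>A\<^esub> y) = \<mu> (y \<otimes>\<^bsub>A\<^esub> x)) \<and>
     (\<forall>x\<in>carrier A. \<mu> (star A x \<otimes>\<^bsub>A\<^esub> x) = 0 \<longrightarrow> x = \<zero>\<^bsub>A\<^esub>)"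

definition conditional_expectation ::
    "'a cstar_algebra \<Rightarrow> 'a set \<Rightarrow> ('a \<Rightarrow> 'a) \<Rightarrow> bool" where
  "conditional_expectation A S E \<longleftrightarrow>
     E \<in> extensional (carrier A) \<and>
     linear_on A (A\<lparr>carrier := S\<rparr>) E \<and>
     (\<forall>b\<in>S. E b = b) \<and>
     (\<forall>a\<in>positive_elements A. E a \<in> positive_elements (A\<lparr>carrier := S\<rparr>)) \<and>
     (\<forall>a\<in>carrier A. nrm A (E a) \<le> nrm A a) \<and>
     (\<forall>b\<in>S. \<forall>c\<in>S. \<forall>a\<in>carrier A.
        E (b \<otimes>\<^bsub>A\<^esub> a \<otimes>\<^bsub>A\<^esub> c) = b \<otimes>\<^bsub>A\<^esub> E a \<otimes>\<^bsub>A\<^esub> c)"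

definition cond_exp ::
    "'a cstar_algebra \<Rightarrow> ('a \<Rightarrow> complex) \<Rightarrow> 'a set \<Rightarrow> 'a \<Rightarrow> 'a" where
  "cond_exp A \<mu> S =
     (THE E. conditional_expectation A S E \<and> (\<forall>a\<in>carrier A. \<mu> (E a) = \<mu> a))"

text \<open>Only the values on \<^term>\<open>self_adjoint A\<close> are relevant.\<close>

definition AF_lip_norm ::
    "'a cstar_algebra \<Rightarrow> (nat \<Rightarrow> 'a set) \<Rightarrow> ('a \<Rightarrow> complex) \<Rightarrow> (nat \<Rightarrow> real) \<Rightarrow> 'a \<Rightarrow> ennreal" where
  "AF_lip_norm A U \<mu> \<beta> a =
     (SUP n. ennreal (nrm A (a \<ominus>\<^bsub>A\<^esub> cond_exp A \<mu> (U n) a) / \<beta> n))"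

section \<open>Quantum compact metric spaces\<close>

text \<open>A pair \<open>(A, L)\<close> of an algebra and a seminorm on its self-adjoint part. The values of \<open>L\<close>
  elsewhere play no role, so \<open>(A\<lparr>carrier := S\<rparr>, L)\<close> is a subalgebra with the restriction of \<open>L\<close>.\<close>

type_synonym 'a qspace = "'a cstar_algebra \<times> ('a \<Rightarrow> ennreal)"

definition lip_domain :: "'a cstar_algebra \<Rightarrow> ('a \<Rightarrow> ennreal) \<Rightarrow> 'a set" where
  "lip_domain A L = {a \<in> self_adjoint A. L a < \<infinity>}"

definition lip_ball :: "'a cstar_algebra \<Rightarrow> ('a \<Rightarrow> ennreal) \<Rightarrow> 'a set" where
  "lip_ball A L = {a \<in> self_adjoint A. L a \<le> 1}"

definition jordan_product :: "'a cstar_algebra \<Rightarrow> 'a \<Rightarrow> 'a \<Rightarrow> 'a" where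
  "jordan_product A a b = (1/2) \<odot>\<^bsub>A\<^esub> (a \<otimes>\<^bsub>A\<^esub> b \<oplus>\<^bsub>A\<^esub> b \<otimes>\<^bsub>A\<^esub> a)"

definition lie_product :: "'a cstar_algebra \<Rightarrow> 'a \<Rightarrow> 'a \<Rightarrow> 'a" where
  "lie_product A a b = (1/(2*\<i>)) \<odot>\<^bsub>A\<^esub> (a \<otimes>\<^bsub>A\<^esub> b \<ominus>\<^bsub>A\<^esub> b \<otimes>\<^bsub>A\<^esub> a)"

definition mk_dist ::
    "'a cstar_algebra \<Rightarrow> ('a \<Rightarrow> ennreal) \<Rightarrow> ('a \<Rightarrow> complex) \<Rightarrow> ('a \<Rightarrow> complex) \<Rightarrow> ennreal" where
  "mk_dist A L \<phi> \<psi> = (SUP a\<in>lip_ball A L. ennreal (cmod (\<phi> a - \<psi> a)))"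

definition quasi_leibniz_qcms :: "real \<Rightarrow> real \<Rightarrow> 'a qspace \<Rightarrow> bool" where
  "quasi_leibniz_qcms C D = (\<lambda>(A, L).
     1 \<le> C \<and> 0 \<le> D \<and> unital_cstar_algebra A \<and>
     \<comment> \<open>seminorm (in \<^typ>\<open>ennreal\<close>, \<open>0 * \<infinity> = 0\<close>)\<close>
     (\<forall>a\<in>self_adjoint A. \<forall>b\<in>self_adjoint A. L (a \<oplus>\<^bsub>A\<^esub> b) \<le> L a + L b) \<and>
     (\<forall>t::real. \<forall>a\<in>self_adjoint A. L (complex_of_real t \<odot>\<^bsub>A\<^esub> a) = ennreal \<bar>t\<bar> * L a) \<and>
     \<comment> \<open>the domain is a dense unital Jordan-Lie subalgebra\<close>
     \<one>\<^bsub>A\<^esub> \<in> lip_domain A L \<and>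
     (\<forall>a\<in>lip_domain A L. \<forall>b\<in>lip_domain A L.
        a \<oplus>\<^bsub>A\<^esub> b \<in> lip_domain A L \<and>
        jordan_product A a b \<in> lip_domain A L \<and> lie_product A a b \<in> lip_domain A L) \<and>
     (\<forall>t::real. \<forall>a\<in>lip_domain A L. complex_of_real t \<odot>\<^bsub>A\<^esub> a \<in> lip_domain A L) \<and>
     self_adjoint A \<subseteq> Abstract_Topology.closure_of (nrm_topology A) (lip_domain A L) \<and>
     {a \<in> self_adjoint A. L a = 0} = real_scalars A \<and>
     \<comment> \<open>quasi-Leibniz inequality\<close>
     (\<forall>a\<in>lip_domain A L. \<forall>b\<in>lip_domain A L.
        max (L (jordan_product A a b)) (L (lie_product A a b))
          \<le> ennreal C * (ennreal (nrm A a) * L b + ennreal (nrm A b) * L a)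
            + ennreal D * L a * L b) \<and>
     \<comment> \<open>the Monge-Kantorovich metric metrizes the weak* topology\<close>
     (\<forall>\<phi>\<in>states A. \<forall>\<psi>\<in>states A. mk_dist A L \<phi> \<psi> < \<infinity>) \<and>
     Metric_space (states A) (\<lambda>\<phi> \<psi>. enn2real (mk_dist A L \<phi> \<psi>)) \<and>
     Metric_space.mtopology (states A) (\<lambda>\<phi> \<psi>. enn2real (mk_dist A L \<phi> \<psi>))
       = weak_star_topology A \<and>
     \<comment> \<open>lower semicontinuity\<close>
     (\<forall>r. closedin (subtopology (nrm_topology A) (self_adjoint A)) {a \<in> self_adjoint A. L a \<le> r}))"

definition quantum_isometry :: "'a qspace \<Rightarrow> 'b qspace \<Rightarrow> ('a \<Rightarrow> 'b) \<Rightarrow> bool" where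
  "quantum_isometry = (\<lambda>(A, LA) (B, LB) \<pi>.
     star_iso A B \<pi> \<and> (\<forall>a\<in>self_adjoint A. LB (\<pi> a) = LA a))"

section \<open>Bridges and the quantum propinquity\<close>

text \<open>The two sets may live in different types, \<open>d\<close> being a distance between their points.\<close>

definition hausdorff_distance :: "('a \<Rightarrow> 'b \<Rightarrow> ennreal) \<Rightarrow> 'a set \<Rightarrow> 'b set \<Rightarrow> ennreal" where
  "hausdorff_distance d S T =
     max (SUP x\<in>S. INF y\<in>T. d x y) (SUP y\<in>T. INF x\<in>S. d x y)"

type_synonym ('a, 'b, 'd) bridge = "'d cstar_algebra \<times> ('a \<Rightarrow> 'd) \<times> ('b \<Rightarrow> 'd) \<times> 'd"

definition one_level_states :: "'d cstar_algebra \<Rightarrow> 'd \<Rightarrow> ('d \<Rightarrow> complex) set" where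
  "one_level_states D \<omega> = {\<phi> \<in> states D.
     \<phi> (\<one>\<^bsub>D\<^esub> \<ominus>\<^bsub>D\<^esub> star D \<omega> \<otimes>\<^bsub>D\<^esub> \<omega>) = 0 \<and>
     \<phi> (\<one>\<^bsub>D\<^esub> \<ominus>\<^bsub>D\<^esub> \<omega> \<otimes>\<^bsub>D\<^esub> star D \<omega>) = 0}"

definition is_bridge ::
    "'a cstar_algebra \<Rightarrow> 'b cstar_algebra \<Rightarrow> ('a, 'b, 'd) bridge \<Rightarrow> bool" where
  "is_bridge A B = (\<lambda>(D, \<pi>A, \<pi>B, \<omega>).
     unital_cstar_algebra D \<and> unital_star_mono A D \<pi>A \<and> unital_star_mono B D \<pi>B \<and>
     \<omega> \<in> carrier D \<and> one_level_states D \<omega> \<noteq> {})"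

definition pullback_states ::
    "'a cstar_algebra \<Rightarrow> 'd cstar_algebra \<Rightarrow> ('a \<Rightarrow> 'd) \<Rightarrow> 'd \<Rightarrow> ('a \<Rightarrow> complex) set" where
  "pullback_states A D \<pi> \<omega> = (\<lambda>\<phi>. compose (carrier A) \<phi> \<pi>) ` one_level_states D \<omega>"

definition bridge_height :: "'a qspace \<Rightarrow> 'b qspace \<Rightarrow> ('a, 'b, 'd) bridge \<Rightarrow> ennreal" where
  "bridge_height = (\<lambda>(A, LA) (B, LB) (D, \<pi>A, \<pi>B, \<omega>).
     max (hausdorff_distance (mk_dist A LA) (states A) (pullback_states A D \<pi>A \<omega>))
         (hausdorff_distance (mk_dist B LB) (states B) (pullback_states B D \<pi>B \<omega>)))"

definition bridge_reach :: "'a qspace \<Rightarrow> 'b qspace \<Rightarrow> ('a, 'b, 'd) bridge \<Rightarrow> ennreal" where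
  "bridge_reach = (\<lambda>(A, LA) (B, LB) (D, \<pi>A, \<pi>B, \<omega>).
     hausdorff_distance
       (\<lambda>a b. ennreal (nrm D (\<pi>A a \<otimes>\<^bsub>D\<^esub> \<omega> \<ominus>\<^bsub>D\<^esub> \<omega> \<otimes>\<^bsub>D\<^esub> \<pi>B b)))
       (lip_ball A LA) (lip_ball B LB))"

definition bridge_length :: "'a qspace \<Rightarrow> 'b qspace \<Rightarrow> ('a, 'b, 'd) bridge \<Rightarrow> ennreal" where
  "bridge_length P Q \<gamma> = max (bridge_height P Q \<gamma>) (bridge_reach P Q \<gamma>)"

text \<open>The class of all C*-algebras is replaced by those carried by one type of cardinality
  continuum. This loses nothing. If \<open>(A, L)\<close> is a quantum compact metric space then the state space
  of \<open>A\<close> is weak* compact and metrizable, so \<open>A\<close> is separable and has an isomorphic copy on a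
  subset of this type. In a bridge, \<open>D\<close> may be replaced by its C*-subalgebra generated by \<open>\<omega>\<close> and
  the images of \<open>\<pi>A\<close> and \<open>\<pi>B\<close>, which is again separable: as states extend from C*-subalgebras,
  the height and the reach do not change.\<close>

type_synonym universe = "nat \<Rightarrow> real"

definition bridge_lengths :: "'a qspace \<Rightarrow> 'b qspace \<Rightarrow> ennreal set" where
  "bridge_lengths P Q =
     {bridge_length P Q \<gamma> | \<gamma> :: ('a, 'b, universe) bridge. is_bridge (fst P) (fst Q) \<gamma>}"

text \<open>The infimum of the lengths of finite chains of bridges from \<open>P\<close> to \<open>Q\<close>: either a single
  bridge, or a chain through intermediate spaces \<open>T 0, \<dots>, T k\<close>. It is meant for \<open>P\<close> and \<open>Q\<close>
  that are themselves \<open>(C, D)\<close>-quasi-Leibniz quantum compact metric spaces.\<close>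

definition propinquity :: "real \<Rightarrow> real \<Rightarrow> 'a qspace \<Rightarrow> 'b qspace \<Rightarrow> ennreal" where
  "propinquity C D P Q =
     Inf (bridge_lengths P Q \<union>
       {p + (\<Sum>i<k. l i) + q | p l q k.
          \<exists>T :: nat \<Rightarrow> universe qspace.
            (\<forall>i\<le>k. quasi_leibniz_qcms C D (T i)) \<and>
            p \<in> bridge_lengths P (T 0) \<and>
            (\<forall>i<k. l i \<in> bridge_lengths (T i) (T (Suc i))) \<and>
            q \<in> bridge_lengths (T k) Q})"

end

(* A unital *-homomorphism is contractive: a self-adjoint a with norm at most 1 is the real part of the
   unitary a + i sqrt(1 - a^2), and unitaries are mapped to unitaries. As phi restricts to
   bijections U n -> V n, both phi and its inverse are contractive there, so phi is isometric on the
   dense union, hence on A, and its range is closed and dense. The conditional expectation onto U n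
   is the orthogonal projection for the inner product mu (x* y), which mu and U n determine; so phi
   intertwines the expectations and therefore the Lip-norms. Finally, the algebras are countably
   generated, hence embed into the universe type, and there the bridge with pivot 1 built from phi
   has length 0. *)
theory Submission
  imports Defs
begin

section \<open>Limits and square roots\<close>

text \<open>Positivity and contractivity are obtained without spectra: the only functional calculus
  is the root of 1 - x for self-adjoint x of norm at most 1. It yields unitaries, the action of
  contractions on the inner product space of the trace, and positive elements of a subalgebra. The
  main labour lies in the expectation. \<open>cond_exp\<close> is a definite description, so the
  orthogonal projection has to meet the whole definition of a conditional expectation before
  anything is known about its values. In particular it must be contractive for the C*-norm and
  positive, whereas orthogonality only controls \<open>nrm2\<close>. The link is finite dimension,
  which bounds the C*-norm by a multiple of \<open>nrm2\<close>; the multiple disappears when growth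
  rates of powers are compared. Traciality moves factors around a product, which makes the
  projection a bimodule map and lets it commute with the involution. The coordinates of the
  embedding into \<open>universe\<close> are inner products with countably many vectors whose span
  is dense.\<close>

context unital_cstar_algebra begin

text \<open>The module axioms speak of the record \<open>ring_of_type_algebra\<close>; this lemma
  and the next ones restate them with the operations of the type \<open>complex\<close>.\<close>

lemma smult_closed [simp]: "x \<in> carrier A \<Longrightarrow> c \<odot> x \<in> carrier A"
  using scalars.smult_closed[of c x] by (simp add: ring_of_type_algebra_def)

lemma smult_add_left: "x \<in> carrier A \<Longrightarrow> (c + d) \<odot> x = c \<odot> x \<oplus> d \<odot> x"
  using scalars.smult_l_distr[of c d x] by (simp add: ring_of_type_algebra_def)

lemma smult_add_right: "x \<in> carrier A \<Longrightarrow> y \<in> carrier A \<Longrightarrow> c \<odot> (x \<oplus> y) = c \<odot> x \<oplus> c \<odot> y"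
  using scalars.smult_r_distr[of c x y] by (simp add: ring_of_type_algebra_def)

lemma smult_smult: "x \<in> carrier A \<Longrightarrow> c \<odot> (d \<odot> x) = (c * d) \<odot> x"
  using scalars.smult_assoc1[of c d x] by (simp add: ring_of_type_algebra_def)

lemma smult_one [simp]: "x \<in> carrier A \<Longrightarrow> 1 \<odot> x = x"
  using scalars.smult_one[of x] by (simp add: ring_of_type_algebra_def)

lemma smult_zero_left [simp]: "x \<in> carrier A \<Longrightarrow> 0 \<odot> x = \<zero>"
  using scalars.smult_l_null[of x] by (simp add: ring_of_type_algebra_def)

lemma smult_zero_right [simp]: "c \<odot> \<zero> = \<zero>"
  using scalars.smult_r_null[of c] by (simp add: ring_of_type_algebra_def)

lemma a_inv_eq_smult: "x \<in> carrier A \<Longrightarrow> \<ominus> x = (-1) \<odot> x"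
proof -
  assume x: "x \<in> carrier A"
  have "(-1) \<odot> x \<oplus> x = ((-1) + 1) \<odot> x" using x by (subst smult_add_left) auto
  then have "(-1) \<odot> x \<oplus> x = \<zero>" using x by simp
  then show ?thesis using x by (simp add: minus_equality)
qed

lemma minus_eq_smult: "x \<in> carrier A \<Longrightarrow> y \<in> carrier A \<Longrightarrow> x \<ominus> y = x \<oplus> (-1) \<odot> y"
  by (simp add: a_minus_def a_inv_eq_smult)

lemmas vec_simps = minus_eq_smult smult_add_right smult_smult smult_mult_left smult_mult_right
  l_distr r_distr star_add star_smult star_mult star_closed star_star m_assoc a_ac

text \<open>Merges coefficients after \<open>vec_simps\<close> has expanded an expression into a sum
  of multiples of monomials. The second variant of each pair applies when the two terms head a
  longer right-nested sum.\<close>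

lemma smult_collect:
  assumes "x \<in> carrier A" "z \<in> carrier A"
  shows "c \<odot> x \<oplus> d \<odot> x = (c + d) \<odot> x" "c \<odot> x \<oplus> (d \<odot> x \<oplus> z) = (c + d) \<odot> x \<oplus> z"
    "x \<oplus> d \<odot> x = (1 + d) \<odot> x" "x \<oplus> (d \<odot> x \<oplus> z) = (1 + d) \<odot> x \<oplus> z"
    "x \<oplus> x = 2 \<odot> x" "x \<oplus> (x \<oplus> z) = 2 \<odot> x \<oplus> z"
    "c \<odot> x \<oplus> x = (c + 1) \<odot> x" "c \<odot> x \<oplus> (x \<oplus> z) = (c + 1) \<odot> x \<oplus> z"
  using assms smult_add_left[of x c d] smult_add_left[of x 1 d] smult_add_left[of x c 1]
    smult_add_left[of x 1 1] by (simp_all flip: a_assoc)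

lemma star_zero [simp]: "star A \<zero> = \<zero>"
  using star_smult[of \<zero> 0] by (simp add: star_closed)

lemma star_one [simp]: "star A \<one> = \<one>"
  by (metis one_closed star_closed star_mult star_star l_one r_one)

lemma nrm_zero [simp]: "nrm A \<zero> = 0"
  using nrm_eq_zero_iff by blast

lemma nrm_star [simp]:
  assumes "x \<in> carrier A" shows "nrm A (star A x) = nrm A x"
proof -
  have *: "nrm A y \<le> nrm A (star A y)" if y: "y \<in> carrier A" for y
  proof -
    have "nrm A y * nrm A y \<le> nrm A (star A y) * nrm A y"
      using nrm_star_mult[OF y] nrm_mult[of "star A y" y] y star_closed by (simp add: power2_eq_square)
    then show ?thesis
      using nrm_nonneg[OF y] nrm_nonneg[OF star_closed[OF y]] by (cases "nrm A y = 0") auto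
  qed
  show ?thesis using *[OF assms] *[of "star A x"] assms star_closed star_star by force
qed

text \<open>The C*-identity leaves the values 0 and 1; the value 0 occurs in the zero algebra, which
  the locale admits.\<close>

lemma nrm_one_le: "nrm A \<one> \<le> 1"
  using nrm_star_mult[of \<one>] nrm_nonneg[of \<one>]
  by (simp add: power2_eq_square) (metis mult_cancel_right1 order.refl zero_le_one)

lemma nrm_minus_commute: "x \<in> carrier A \<Longrightarrow> y \<in> carrier A \<Longrightarrow> nrm A (x \<ominus> y) = nrm A (y \<ominus> x)"
  using nrm_smult[of "y \<ominus> x" "-1"] by (simp add: vec_simps)

lemma minus_telescope:
  "x \<in> carrier A \<Longrightarrow> y \<in> carrier A \<Longrightarrow> z \<in> carrier A \<Longrightarrow> (x \<ominus> y) \<oplus> (y \<ominus> z) = x \<ominus> z"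
  by (simp add: vec_simps smult_collect)

lemma minus_add_cancel: "x \<in> carrier A \<Longrightarrow> y \<in> carrier A \<Longrightarrow> (x \<ominus> y) \<oplus> y = x"
  by (simp add: a_minus_def a_assoc l_neg)

lemma mult_minus_distrib:
  assumes "x \<in> carrier A" "y \<in> carrier A" "z \<in> carrier A"
  shows "x \<otimes> (y \<ominus> z) = x \<otimes> y \<ominus> x \<otimes> z" "(x \<ominus> y) \<otimes> z = x \<otimes> z \<ominus> y \<otimes> z"
  using assms by (simp_all add: vec_simps)

lemma nrm_triangle:
  assumes "x \<in> carrier A" "y \<in> carrier A" "z \<in> carrier A"
  shows "nrm A (x \<ominus> z) \<le> nrm A (x \<ominus> y) + nrm A (y \<ominus> z)"
proof -
  show ?thesis using nrm_add[of "x \<ominus> y" "y \<ominus> z"] assms by (simp add: minus_telescope)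
qed

lemma Metric_space_nrm: "Metric_space (carrier A) (nrm_dist A)"
proof
  fix x y z
  show "0 \<le> nrm_dist A x y" by (simp add: nrm_dist_def nrm_nonneg)
  show "nrm_dist A x y = nrm_dist A y x" by (simp add: nrm_dist_def nrm_minus_commute)
  assume xy: "x \<in> carrier A" "y \<in> carrier A"
  have "x \<ominus> y = \<zero> \<longleftrightarrow> x = y" using xy by (simp add: r_right_minus_eq)
  then show "nrm_dist A x y = 0 \<longleftrightarrow> x = y" using xy by (simp add: nrm_dist_def nrm_eq_zero_iff)
  assume z: "z \<in> carrier A"
  show "nrm_dist A x z \<le> nrm_dist A x y + nrm_dist A y z"
    using xy z by (simp add: nrm_dist_def nrm_triangle)
qed

text \<open>Convergence is expressed by a real sequence, so that the limit calculus of the reals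
  applies; \<open>Cauchy_tends\<close> connects it with the completeness axiom.\<close>

definition tends :: "(nat \<Rightarrow> 'a) \<Rightarrow> 'a \<Rightarrow> bool" where
  "tends s l \<longleftrightarrow> (\<forall>n. s n \<in> carrier A) \<and> l \<in> carrier A \<and> (\<lambda>n. nrm A (s n \<ominus> l)) \<longlonglongrightarrow> 0"

lemma Cauchy_tends:
  assumes s: "\<And>n. s n \<in> carrier A"
    and "\<And>e. e > 0 \<Longrightarrow> \<exists>N. \<forall>m\<ge>N. \<forall>n\<ge>N. nrm A (s m \<ominus> s n) < e"
  shows "\<exists>l. tends s l"
proof -
  interpret Metric_space "carrier A" "nrm_dist A" by (rule Metric_space_nrm)
  have "MCauchy s" unfolding MCauchy_def using assms by (auto simp: nrm_dist_def)
  then obtain l where l: "limitin mtopology s l sequentially"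
    using nrm_complete unfolding mcomplete_def by blast
  then have "l \<in> carrier A" "\<And>e. e > 0 \<Longrightarrow> \<exists>N. \<forall>n\<ge>N. nrm_dist A (s n) l < e"
    unfolding limit_metric_sequentially by blast+
  then have "tends s l" unfolding tends_def using s
    by (auto simp: LIMSEQ_def nrm_dist_def nrm_nonneg)
  then show ?thesis ..
qed

lemma tends_unique:
  assumes "tends s l" "tends s m" shows "l = m"
proof -
  have c: "l \<in> carrier A" "m \<in> carrier A" "\<And>n. s n \<in> carrier A" using assms by (auto simp: tends_def)
  have "(\<lambda>n. nrm A (s n \<ominus> l) + nrm A (s n \<ominus> m)) \<longlonglongrightarrow> 0 + 0"
    using assms unfolding tends_def by (intro tendsto_add) auto
  moreover have "nrm A (l \<ominus> m) \<le> nrm A (s n \<ominus> l) + nrm A (s n \<ominus> m)" for n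
    using nrm_triangle[of l "s n" m] c by (simp add: nrm_minus_commute)
  ultimately have "nrm A (l \<ominus> m) \<le> 0" by (intro LIMSEQ_le_const) auto
  then show ?thesis using c nrm_nonneg[of "l \<ominus> m"] nrm_eq_zero_iff[of "l \<ominus> m"]
    by (simp add: r_right_minus_eq)
qed

lemma tendsI:
  assumes "\<And>n. s n \<in> carrier A" "l \<in> carrier A" "\<And>n. nrm A (s n \<ominus> l) \<le> f n" "f \<longlonglongrightarrow> 0"
  shows "tends s l"
  unfolding tends_def using assms
  by (auto intro!: tendsto_sandwich[of "\<lambda>_. 0" "\<lambda>n. nrm A (s n \<ominus> l)" _ f] simp: nrm_nonneg)

lemma tends_const: "x \<in> carrier A \<Longrightarrow> tends (\<lambda>_. x) x"
  by (simp add: tends_def r_right_minus_eq[THEN iffD2])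

lemma tends_add:
  assumes "tends s l" "tends t m" shows "tends (\<lambda>n. s n \<oplus> t n) (l \<oplus> m)"
proof (rule tendsI)
  have c: "l \<in> carrier A" "m \<in> carrier A" "\<And>n. s n \<in> carrier A" "\<And>n. t n \<in> carrier A"
    using assms by (auto simp: tends_def)
  show "(\<lambda>n. nrm A (s n \<ominus> l) + nrm A (t n \<ominus> m)) \<longlonglongrightarrow> 0"
    using assms unfolding tends_def by (auto intro: tendsto_add_zero)
  show "s n \<oplus> t n \<in> carrier A" for n using c by simp
  show "l \<oplus> m \<in> carrier A" using c by simp
  show "nrm A (s n \<oplus> t n \<ominus> (l \<oplus> m)) \<le> nrm A (s n \<ominus> l) + nrm A (t n \<ominus> m)" for n
    using nrm_add[of "s n \<ominus> l" "t n \<ominus> m"] c by (simp add: vec_simps)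
qed

lemma tends_smult:
  assumes "tends s l" shows "tends (\<lambda>n. c \<odot> s n) (c \<odot> l)"
proof (rule tendsI)
  have c: "l \<in> carrier A" "\<And>n. s n \<in> carrier A" using assms by (auto simp: tends_def)
  show "(\<lambda>n. cmod c * nrm A (s n \<ominus> l)) \<longlonglongrightarrow> 0"
    using assms unfolding tends_def by (auto intro: tendsto_mult_right_zero)
  show "c \<odot> s n \<in> carrier A" for n using c by simp
  show "c \<odot> l \<in> carrier A" using c by simp
  have "c \<odot> s n \<ominus> c \<odot> l = c \<odot> (s n \<ominus> l)" for n using c by (simp add: vec_simps)
  then show "nrm A (c \<odot> s n \<ominus> c \<odot> l) \<le> cmod c * nrm A (s n \<ominus> l)" for n
    using nrm_smult c by simp
qed

lemma tends_star:
  assumes "tends s l" shows "tends (\<lambda>n. star A (s n)) (star A l)"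
proof (rule tendsI)
  have c: "l \<in> carrier A" "\<And>n. s n \<in> carrier A" using assms by (auto simp: tends_def)
  show "(\<lambda>n. nrm A (s n \<ominus> l)) \<longlonglongrightarrow> 0"
    using assms unfolding tends_def by auto
  show "star A (s n) \<in> carrier A" for n using c star_closed by simp
  show "star A l \<in> carrier A" using c star_closed by simp
  have "star A (s n) \<ominus> star A l = star A (s n \<ominus> l)" for n using c by (simp add: vec_simps)
  then show "nrm A (star A (s n) \<ominus> star A l) \<le> nrm A (s n \<ominus> l)" for n
    using c by simp
qed

lemma tends_mult:
  assumes "tends s l" "tends t m" shows "tends (\<lambda>n. s n \<otimes> t n) (l \<otimes> m)"
proof (rule tendsI)
  have c: "l \<in> carrier A" "m \<in> carrier A" "\<And>n. s n \<in> carrier A" "\<And>n. t n \<in> carrier A"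
    using assms by (auto simp: tends_def)
  have lim: "(\<lambda>n. nrm A (s n \<ominus> l)) \<longlonglongrightarrow> 0" "(\<lambda>n. nrm A (t n \<ominus> m)) \<longlonglongrightarrow> 0"
    using assms unfolding tends_def by auto
  \<comment> \<open>The first factor bounds nrm (s n) by nrm (s n - l) + nrm l, which replaces an
    argument that convergent sequences are bounded.\<close>
  show "(\<lambda>n. (nrm A (s n \<ominus> l) + nrm A l) * nrm A (t n \<ominus> m) + nrm A (s n \<ominus> l) * nrm A m) \<longlonglongrightarrow> 0"
    using tendsto_add[OF tendsto_mult[OF tendsto_add[OF lim(1) tendsto_const[of "nrm A l"]] lim(2)]
        tendsto_mult[OF lim(1) tendsto_const[of "nrm A m"]]] by simp
  show "s n \<otimes> t n \<in> carrier A" for n using c by simp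
  show "l \<otimes> m \<in> carrier A" using c by simp
  show "nrm A (s n \<otimes> t n \<ominus> (l \<otimes> m))
      \<le> (nrm A (s n \<ominus> l) + nrm A l) * nrm A (t n \<ominus> m) + nrm A (s n \<ominus> l) * nrm A m" for n
  proof -
    have "s n \<otimes> t n \<ominus> (l \<otimes> m) = s n \<otimes> (t n \<ominus> m) \<oplus> (s n \<ominus> l) \<otimes> m"
      using c by (simp add: mult_minus_distrib minus_telescope)
    then have "nrm A (s n \<otimes> t n \<ominus> (l \<otimes> m)) \<le> nrm A (s n) * nrm A (t n \<ominus> m) + nrm A (s n \<ominus> l) * nrm A m"
      using nrm_add[of "s n \<otimes> (t n \<ominus> m)" "(s n \<ominus> l) \<otimes> m"] nrm_mult[of "s n" "t n \<ominus> m"]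
        nrm_mult[of "s n \<ominus> l" m] c by simp
    moreover have "nrm A (s n) \<le> nrm A (s n \<ominus> l) + nrm A l"
    proof -
      show ?thesis using nrm_add[of "s n \<ominus> l" l] c by (simp add: minus_add_cancel)
    qed
    ultimately show ?thesis
      using mult_right_mono[of "nrm A (s n)" "nrm A (s n \<ominus> l) + nrm A l" "nrm A (t n \<ominus> m)"]
        nrm_nonneg[of "t n \<ominus> m"] c by simp
  qed
qed

text \<open>Iterating \<open>y \<mapsto> (x + y\<^sup>2) / 2\<close> from 0 gives polynomials in \<open>x\<close> with nonnegative coefficients that
  converge to \<open>1 - \<surd>(1 - x)\<close>. Hence for norm at most 1 the increments are dominated by those of the
  scalar iteration at \<open>x = 1\<close>.\<close>

fun sqrt_iter :: "'a \<Rightarrow> nat \<Rightarrow> 'a" where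
  "sqrt_iter x 0 = \<zero>"
| "sqrt_iter x (Suc n) = (1/2) \<odot> (x \<oplus> sqrt_iter x n \<otimes> sqrt_iter x n)"

end

fun real_sqrt_iter :: "nat \<Rightarrow> real" where
  "real_sqrt_iter 0 = 0"
| "real_sqrt_iter (Suc n) = (1 + real_sqrt_iter n * real_sqrt_iter n) / 2"

lemma real_sqrt_iter_bounds: "0 \<le> real_sqrt_iter n \<and> real_sqrt_iter n \<le> 1"
proof (induction n)
  case (Suc n)
  then show ?case using mult_le_one[of "real_sqrt_iter n" "real_sqrt_iter n"] by simp
qed simp

lemma real_sqrt_iter_Cauchy: "Cauchy real_sqrt_iter"
proof -
  \<comment> \<open>The increment is (1 - r)^2 / 2 for r = \<open>real_sqrt_iter n\<close>.\<close>
  have "real_sqrt_iter n \<le> real_sqrt_iter (Suc n)" for n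
    using sum_squares_ge_zero[of "1 - real_sqrt_iter n" 0] by (simp add: algebra_simps)
  then have "incseq real_sqrt_iter" by (simp add: incseq_Suc_iff)
  then have "convergent real_sqrt_iter"
    using real_sqrt_iter_bounds incseq_convergent[of real_sqrt_iter 1] by (meson convergentI)
  then show ?thesis by (simp add: convergent_Cauchy)
qed

section \<open>Convergence of the square root iteration\<close>

context unital_cstar_algebra begin

lemma sqrt_iter_closed [simp]: "x \<in> carrier A \<Longrightarrow> sqrt_iter x n \<in> carrier A"
  by (induction n) auto

lemma nrm_sqrt_iter_le:
  assumes x: "x \<in> carrier A" "nrm A x \<le> 1"
  shows "nrm A (sqrt_iter x n) \<le> real_sqrt_iter n"
proof (induction n)
  case (Suc n)
  have "nrm A (sqrt_iter x (Suc n)) = nrm A (x \<oplus> sqrt_iter x n \<otimes> sqrt_iter x n) / 2"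
    using x by (simp add: nrm_smult)
  also have "\<dots> \<le> (nrm A x + nrm A (sqrt_iter x n) * nrm A (sqrt_iter x n)) / 2"
    using nrm_add[of x "sqrt_iter x n \<otimes> sqrt_iter x n"] nrm_mult[of "sqrt_iter x n" "sqrt_iter x n"] x
    by simp
  also have "\<dots> \<le> real_sqrt_iter (Suc n)"
    using x Suc.IH mult_mono[OF Suc.IH Suc.IH] real_sqrt_iter_bounds[of n] nrm_nonneg[of "sqrt_iter x n"]
    by simp
  finally show ?case .
qed simp

text \<open>A difference of squares is y (y - z) + (y - z) z, even if y and z do not commute. With
  norms replaced by their scalar bounds this becomes p^2 - q^2, the increment of the scalar
  iteration.\<close>

lemma nrm_sqrt_iter_diff:
  assumes x: "x \<in> carrier A" "nrm A x \<le> 1"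
  shows "nrm A (sqrt_iter x (n + k) \<ominus> sqrt_iter x n) \<le> real_sqrt_iter (n + k) - real_sqrt_iter n"
proof (induction n)
  case 0
  then show ?case using nrm_sqrt_iter_le[OF x, of k] x by (simp add: minus_eq_smult)
next
  case (Suc n)
  define y z where "y = sqrt_iter x (n + k)" and "z = sqrt_iter x n"
  define p q where "p = real_sqrt_iter (n + k)" and "q = real_sqrt_iter n"
  have c: "y \<in> carrier A" "z \<in> carrier A" using x by (auto simp: y_def z_def)
  have le: "nrm A y \<le> p" "nrm A z \<le> q" "nrm A (y \<ominus> z) \<le> p - q" "0 \<le> p" "0 \<le> q"
    using nrm_sqrt_iter_le[OF x] Suc.IH real_sqrt_iter_bounds by (auto simp: y_def z_def p_def q_def)
  have "sqrt_iter x (Suc n + k) \<ominus> sqrt_iter x (Suc n) = (1/2) \<odot> (y \<otimes> (y \<ominus> z) \<oplus> (y \<ominus> z) \<otimes> z)"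
    using x c by (simp add: vec_simps smult_collect flip: y_def z_def)
  then have "nrm A (sqrt_iter x (Suc n + k) \<ominus> sqrt_iter x (Suc n))
      = nrm A (y \<otimes> (y \<ominus> z) \<oplus> (y \<ominus> z) \<otimes> z) / 2" using c by (simp add: nrm_smult)
  also have "\<dots> \<le> (nrm A y * nrm A (y \<ominus> z) + nrm A (y \<ominus> z) * nrm A z) / 2"
    using nrm_add[of "y \<otimes> (y \<ominus> z)" "(y \<ominus> z) \<otimes> z"] nrm_mult[of y "y \<ominus> z"] nrm_mult[of "y \<ominus> z" z] c
    by simp
  also have "\<dots> \<le> (p * (p - q) + (p - q) * q) / 2"
    using mult_mono[OF le(1,3)] mult_mono[OF le(3,2)] le nrm_nonneg[of "y \<ominus> z"] nrm_nonneg[of z] c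
    by simp
  also have "\<dots> = real_sqrt_iter (Suc n + k) - real_sqrt_iter (Suc n)"
    by (simp add: p_def q_def field_simps)
  finally show ?case .
qed

lemma tends_Suc: "tends s l \<Longrightarrow> tends (\<lambda>n. s (Suc n)) l"
  unfolding tends_def by (auto intro: LIMSEQ_Suc)

text \<open>The limit y of the iteration is a fixed point, y = (x + y^2) / 2, which says (1 - y)^2 =
  1 - x. Self-adjointness and commutation hold for all iterates and pass to the limit. The
  commutation property is what makes a + i s unitary for the root s of 1 - a^2.\<close>

lemma exists_sqrt:
  assumes x: "x \<in> carrier A" "star A x = x" "nrm A x \<le> 1"
  obtains s where "s \<in> carrier A" "star A s = s" "s \<otimes> s = \<one> \<ominus> x"
    "\<And>a. a \<in> carrier A \<Longrightarrow> a \<otimes> x = x \<otimes> a \<Longrightarrow> a \<otimes> s = s \<otimes> a"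
proof -
  have "\<exists>N. \<forall>m\<ge>N. \<forall>n\<ge>N. nrm A (sqrt_iter x m \<ominus> sqrt_iter x n) < e" if e: "e > 0" for e
  proof -
    have *: "nrm A (sqrt_iter x m \<ominus> sqrt_iter x n) \<le> \<bar>real_sqrt_iter m - real_sqrt_iter n\<bar>" for m n
    proof (cases "n \<le> m")
      case True
      then show ?thesis using nrm_sqrt_iter_diff[OF x(1,3), of n "m - n"] by simp
    next
      case False
      then show ?thesis using nrm_sqrt_iter_diff[OF x(1,3), of m "n - m"] x(1)
        by (simp add: nrm_minus_commute)
    qed
    obtain N where "\<forall>m\<ge>N. \<forall>n\<ge>N. \<bar>real_sqrt_iter m - real_sqrt_iter n\<bar> < e"
      using real_sqrt_iter_Cauchy e unfolding Cauchy_def dist_real_def by blast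
    then show ?thesis using * by (meson le_less_trans)
  qed
  then obtain y where y: "tends (sqrt_iter x) y" using Cauchy_tends[of "sqrt_iter x"] x by auto
  then have yc: "y \<in> carrier A" by (simp add: tends_def)
  have "tends (\<lambda>n. sqrt_iter x (Suc n)) ((1/2) \<odot> (x \<oplus> y \<otimes> y))"
    unfolding sqrt_iter.simps by (intro tends_smult tends_add tends_mult tends_const y x)
  then have fix_y: "(1/2) \<odot> (x \<oplus> y \<otimes> y) = y" using tends_unique tends_Suc[OF y] by blast
  have "star A (sqrt_iter x n) = sqrt_iter x n" for n
    using x by (induction n) (auto simp: vec_simps)
  then have star_y: "star A y = y" using tends_unique[OF tends_star[OF y]] y by simp
  have comm_y: "a \<otimes> y = y \<otimes> a" if a: "a \<in> carrier A" "a \<otimes> x = x \<otimes> a" for a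
  proof -
    have "a \<otimes> sqrt_iter x n = sqrt_iter x n \<otimes> a" for n
    proof (induction n)
      case (Suc n)
      have "a \<otimes> (sqrt_iter x n \<otimes> sqrt_iter x n) = sqrt_iter x n \<otimes> sqrt_iter x n \<otimes> a"
        using Suc a x by (metis m_assoc sqrt_iter_closed)
      then show ?case using a x by (simp add: smult_mult_left smult_mult_right l_distr r_distr)
    qed (use a in simp)
    then show ?thesis
      using tends_unique[OF tends_mult[OF tends_const[OF a(1)] y]] tends_mult[OF y tends_const[OF a(1)]]
      by simp
  qed
  have "x \<oplus> y \<otimes> y = 2 \<odot> y"
    using arg_cong[OF fix_y, of "\<lambda>v. 2 \<odot> v"] x yc by (simp add: smult_smult)
  then have "x = 2 \<odot> y \<ominus> y \<otimes> y"
    using x yc by (metis add.inv_solve_right m_closed smult_closed a_minus_def)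
  then have sq: "(\<one> \<ominus> y) \<otimes> (\<one> \<ominus> y) = \<one> \<ominus> x"
    using yc by (simp add: vec_simps smult_collect)
  show thesis
  proof
    show "\<one> \<ominus> y \<in> carrier A" using yc by simp
    show "star A (\<one> \<ominus> y) = \<one> \<ominus> y" using yc star_y by (simp add: vec_simps)
    show "(\<one> \<ominus> y) \<otimes> (\<one> \<ominus> y) = \<one> \<ominus> x" by (rule sq)
    show "a \<otimes> (\<one> \<ominus> y) = (\<one> \<ominus> y) \<otimes> a" if "a \<in> carrier A" "a \<otimes> x = x \<otimes> a" for a
      using that yc comm_y[OF that] by (simp add: minus_eq_smult l_distr r_distr smult_mult_left smult_mult_right)
  qed
qed

end

section \<open>Contractivity of star homomorphisms\<close>

lemma unital_star_homD:
  assumes "unital_star_hom A B f"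
  shows "x \<in> carrier A \<Longrightarrow> f x \<in> carrier B"
    "\<lbrakk>x \<in> carrier A; y \<in> carrier A\<rbrakk> \<Longrightarrow> f (x \<oplus>\<^bsub>A\<^esub> y) = f x \<oplus>\<^bsub>B\<^esub> f y"
    "\<lbrakk>x \<in> carrier A; y \<in> carrier A\<rbrakk> \<Longrightarrow> f (x \<otimes>\<^bsub>A\<^esub> y) = f x \<otimes>\<^bsub>B\<^esub> f y"
    "f \<one>\<^bsub>A\<^esub> = \<one>\<^bsub>B\<^esub>"
    "x \<in> carrier A \<Longrightarrow> f (c \<odot>\<^bsub>A\<^esub> x) = c \<odot>\<^bsub>B\<^esub> f x"
    "x \<in> carrier A \<Longrightarrow> f (star A x) = star B (f x)"
  using assms unfolding unital_star_hom_def linear_on_def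
  by (auto simp: ring_hom_add ring_hom_mult ring_hom_one)

lemma unital_star_hom_minus:
  assumes "unital_cstar_algebra A" "unital_cstar_algebra B" "unital_star_hom A B f"
    and xy: "x \<in> carrier A" "y \<in> carrier A"
  shows "f (x \<ominus>\<^bsub>A\<^esub> y) = f x \<ominus>\<^bsub>B\<^esub> f y"
proof -
  interpret A: unital_cstar_algebra A by fact
  interpret B: unital_cstar_algebra B by fact
  show ?thesis using xy by (simp add: A.minus_eq_smult B.minus_eq_smult unital_star_homD[OF assms(3)])
qed

text \<open>For self-adjoint \<open>a\<close> with norm at most 1 the element \<open>a + \<i> \<surd>(1 - a\<^sup>2)\<close> is unitary, and the
  real part of a unitary has norm at most 1.\<close>

lemma unital_star_hom_self_adjoint_unit_ball:
  assumes "unital_cstar_algebra A" "unital_cstar_algebra B" and f: "unital_star_hom A B f"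
    and a: "a \<in> carrier A" "star A a = a" "nrm A a \<le> 1"
  shows "nrm B (f a) \<le> 1"
proof -
  interpret A: unital_cstar_algebra A by fact
  interpret B: unital_cstar_algebra B by fact
  note h = unital_star_homD[OF f]
  have "nrm A (a \<otimes>\<^bsub>A\<^esub> a) \<le> 1"
    using A.nrm_mult[OF a(1,1)] a A.nrm_nonneg[OF a(1)] mult_le_one[of "nrm A a" "nrm A a"] by linarith
  \<comment> \<open>The root is taken in \<open>A\<close>, where the norm bound is known; only
    algebraic identities are carried to \<open>B\<close>.\<close>
  then obtain s where s: "s \<in> carrier A" "star A s = s" "s \<otimes>\<^bsub>A\<^esub> s = \<one>\<^bsub>A\<^esub> \<ominus>\<^bsub>A\<^esub> a \<otimes>\<^bsub>A\<^esub> a"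
    "a \<otimes>\<^bsub>A\<^esub> s = s \<otimes>\<^bsub>A\<^esub> a"
    using A.exists_sqrt[of "a \<otimes>\<^bsub>A\<^esub> a"] a A.star_mult by (metis A.m_assoc A.m_closed)
  define x y where "x = f a" and "y = f s"
  have xy: "x \<in> carrier B" "y \<in> carrier B" "star B x = x" "star B y = y" "x \<otimes>\<^bsub>B\<^esub> y = y \<otimes>\<^bsub>B\<^esub> x"
    using a s h by (auto simp: x_def y_def) metis+
  have "s \<otimes>\<^bsub>A\<^esub> s \<oplus>\<^bsub>A\<^esub> a \<otimes>\<^bsub>A\<^esub> a = \<one>\<^bsub>A\<^esub>" using s a by (simp add: A.minus_add_cancel)
  then have "f (s \<otimes>\<^bsub>A\<^esub> s \<oplus>\<^bsub>A\<^esub> a \<otimes>\<^bsub>A\<^esub> a) = \<one>\<^bsub>B\<^esub>" using h(4) by simp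
  then have sum1: "y \<otimes>\<^bsub>B\<^esub> y \<oplus>\<^bsub>B\<^esub> x \<otimes>\<^bsub>B\<^esub> x = \<one>\<^bsub>B\<^esub>"
    using a(1) s(1) h(2,3) by (simp add: x_def y_def)
  define u where "u = x \<oplus>\<^bsub>B\<^esub> \<i> \<odot>\<^bsub>B\<^esub> y"
  have u: "u \<in> carrier B" using xy by (simp add: u_def)
  \<comment> \<open>The mixed terms i x y and - i y x cancel because x and y commute.\<close>
  have "star B u \<otimes>\<^bsub>B\<^esub> u = y \<otimes>\<^bsub>B\<^esub> y \<oplus>\<^bsub>B\<^esub> x \<otimes>\<^bsub>B\<^esub> x"
    using xy by (simp add: u_def B.vec_simps B.smult_collect)
  then have "(nrm B u)\<^sup>2 \<le> 1" using B.nrm_star_mult[OF u] B.nrm_one_le sum1 by simp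
  then have u1: "nrm B u \<le> 1" using power2_le_imp_le[of "nrm B u" 1] by simp
  have "x = (1/2) \<odot>\<^bsub>B\<^esub> (u \<oplus>\<^bsub>B\<^esub> star B u)"
    using xy by (simp add: u_def B.vec_simps B.smult_collect)
  then have "nrm B x = nrm B (u \<oplus>\<^bsub>B\<^esub> star B u) / 2" using u by (simp add: B.nrm_smult B.star_closed)
  then show ?thesis using u1 B.nrm_add[of u "star B u"] u B.star_closed by (simp add: x_def)
qed

text \<open>The C*-identity reduces the bound to the self-adjoint element a* a, and dividing by the
  norm reduces that to the unit ball.\<close>

lemma unital_star_hom_contractive:
  assumes "unital_cstar_algebra A" "unital_cstar_algebra B" and f: "unital_star_hom A B f"
    and a: "a \<in> carrier A"
  shows "nrm B (f a) \<le> nrm A a"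
proof -
  interpret A: unital_cstar_algebra A by fact
  interpret B: unital_cstar_algebra B by fact
  note h = unital_star_homD[OF f]
  have sa: "nrm B (f b) \<le> nrm A b" if b: "b \<in> carrier A" "star A b = b" for b
  proof (cases "nrm A b = 0")
    case True
    then have "b = \<zero>\<^bsub>A\<^esub>" using b A.nrm_eq_zero_iff by simp
    moreover have "f \<zero>\<^bsub>A\<^esub> = \<zero>\<^bsub>B\<^esub>" using h(5)[of "\<zero>\<^bsub>A\<^esub>" 0] h(1) by simp
    ultimately show ?thesis by simp
  next
    case False
    define c where "c = complex_of_real (1 / nrm A b)"
    have pos: "nrm A b > 0" using False A.nrm_nonneg[OF b(1)] by simp
    have "nrm B (f (c \<odot>\<^bsub>A\<^esub> b)) \<le> 1"
      using b pos A.star_smult[of b c] A.nrm_smult[of b c]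
      by (intro unital_star_hom_self_adjoint_unit_ball[OF assms(1-3)]) (auto simp: c_def norm_divide)
    then show ?thesis using b pos h by (simp add: B.nrm_smult c_def norm_divide)
  qed
  have "(nrm B (f a))\<^sup>2 = nrm B (f (star A a \<otimes>\<^bsub>A\<^esub> a))"
    using a h by (simp add: B.nrm_star_mult A.star_closed)
  also have "\<dots> \<le> nrm A (star A a \<otimes>\<^bsub>A\<^esub> a)"
    using a by (intro sa) (auto simp: A.star_closed A.star_mult A.star_star)
  also have "\<dots> = (nrm A a)\<^sup>2" using a by (rule A.nrm_star_mult)
  finally show ?thesis using A.nrm_nonneg[OF a] by (rule power2_le_imp_le)
qed

lemma star_iso_inv_into:
  assumes A: "unital_cstar_algebra A" and f: "star_iso A B f"
  shows "star_iso B A (inv_into (carrier A) f)"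
proof -
  interpret A: unital_cstar_algebra A by fact
  have hom: "unital_star_hom A B f" and bij: "bij_betw f (carrier A) (carrier B)"
    using f by (auto simp: star_iso_def)
  note h = unital_star_homD[OF hom]
  define g where "g = inv_into (carrier A) f"
  have g: "g y \<in> carrier A" "f (g y) = y" if "y \<in> carrier B" for y
    using that bij bij_betw_inv_into[OF bij]
    by (auto simp: g_def bij_betw_inv_into_right dest: bij_betwE)
  have eq: "g y = x" if "x \<in> carrier A" "f x = y" for x y
    using that bij by (auto simp: g_def bij_betw_inv_into_left)
  have "unital_star_hom B A g"
    unfolding unital_star_hom_def linear_on_def
  proof (intro conjI ballI allI)
    show "g \<in> ring_hom B A"
      by (rule ring_hom_memI) (auto intro!: eq simp: g h)
    show "g \<in> carrier B \<rightarrow> carrier A" using g by auto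
  qed (auto intro!: eq simp: g h A.star_closed)
  moreover have "bij_betw g (carrier B) (carrier A)" unfolding g_def using bij by (rule bij_betw_inv_into)
  ultimately show ?thesis by (simp add: star_iso_def g_def)
qed

lemma star_iso_nrm:
  assumes A: "unital_cstar_algebra A" and B: "unital_cstar_algebra B" and f: "star_iso A B f"
    and a: "a \<in> carrier A"
  shows "nrm B (f a) = nrm A a"
proof (rule antisym)
  have bij: "bij_betw f (carrier A) (carrier B)" using f by (simp add: star_iso_def)
  show "nrm B (f a) \<le> nrm A a"
    using unital_star_hom_contractive[OF A B _ a] f by (simp add: star_iso_def)
  have "nrm A (inv_into (carrier A) f (f a)) \<le> nrm B (f a)"
    using unital_star_hom_contractive[OF B A, of _ "f a"] star_iso_inv_into[OF A f] a bij
    by (auto simp: star_iso_def dest: bij_betwE)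
  then show "nrm A a \<le> nrm B (f a)" using a bij by (simp add: bij_betw_inv_into_left)
qed

lemma star_iso_subalgebra:
  assumes f: "unital_star_mono A B f" and S: "S \<subseteq> carrier A" and T: "f ` S = T"
  shows "star_iso (A\<lparr>carrier := S\<rparr>) (B\<lparr>carrier := T\<rparr>) f"
proof -
  have hom: "unital_star_hom A B f" and inj: "inj_on f (carrier A)"
    using f by (auto simp: unital_star_mono_def)
  note h = unital_star_homD(2,3)[OF hom, OF subsetD[OF S] subsetD[OF S]]
    unital_star_homD(4)[OF hom] unital_star_homD(5,6)[OF hom, OF subsetD[OF S]]
  have "f \<in> ring_hom (A\<lparr>carrier := S\<rparr>) (B\<lparr>carrier := T\<rparr>)"
    by (rule ring_hom_memI) (use S T h in auto)
  then have "unital_star_hom (A\<lparr>carrier := S\<rparr>) (B\<lparr>carrier := T\<rparr>) f"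
    using T h unfolding unital_star_hom_def linear_on_def by auto
  moreover have "bij_betw f S T" using inj S T by (auto simp: bij_betw_def intro: inj_on_subset)
  ultimately show ?thesis by (simp add: star_iso_def)
qed

text \<open>Negatives are defined by a description that refers to the carrier, so replacing the
  carrier might change them; expressing them as multiples by -1 removes that dependence.\<close>

lemma minus_subalgebra:
  assumes "unital_cstar_algebra A" "unital_cstar_subalgebra S A" "x \<in> S" "y \<in> S"
  shows "x \<ominus>\<^bsub>A\<lparr>carrier := S\<rparr>\<^esub> y = x \<ominus>\<^bsub>A\<^esub> y"
proof -
  interpret A: unital_cstar_algebra A by fact
  interpret S: unital_cstar_algebra "A\<lparr>carrier := S\<rparr>"
    using assms(2) by (simp add: unital_cstar_subalgebra_def)
  have "x \<in> carrier A" "y \<in> carrier A" using assms by (auto simp: unital_cstar_subalgebra_def)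
  then show ?thesis using assms S.minus_eq_smult[of x y] A.minus_eq_smult[of x y] by simp
qed

lemma AF_sequence_dense:
  assumes "AF_sequence A U" "a \<in> carrier A" "e > 0"
  obtains n b where "b \<in> U n" "b \<in> carrier A" "nrm A (a \<ominus>\<^bsub>A\<^esub> b) < e"
proof -
  interpret A: unital_cstar_algebra A using assms by (simp add: AF_sequence_def)
  interpret M: Metric_space "carrier A" "nrm_dist A" by (rule A.Metric_space_nrm)
  have "a \<in> M.mtopology closure_of (\<Union>n. U n)"
    using assms by (simp add: AF_sequence_def nrm_topology_def)
  then obtain b where b: "b \<in> (\<Union>n. U n)" "b \<in> M.mball a e"
    using \<open>e > 0\<close> unfolding M.metric_closure_of by blast
  then obtain n where "b \<in> U n" by blast
  then show thesis using that[of b n] b(2) by (auto simp: nrm_dist_def)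
qed

lemma AF_sequence_star_iso:
  assumes U: "AF_sequence A U" and V: "AF_sequence B V"
    and f: "unital_star_mono A B f" and UV: "\<And>n. f ` U n = V n"
  shows "star_iso A B f"
proof -
  have cA: "unital_cstar_algebra A" and cB: "unital_cstar_algebra B"
    using U V by (auto simp: AF_sequence_def)
  interpret A: unital_cstar_algebra A by fact
  interpret B: unital_cstar_algebra B by fact
  have hom: "unital_star_hom A B f" and inj: "inj_on f (carrier A)"
    using f by (auto simp: unital_star_mono_def)
  note h = unital_star_homD[OF hom]
  have sub: "U n \<subseteq> carrier A" "V n \<subseteq> carrier B"
    "unital_cstar_algebra (A\<lparr>carrier := U n\<rparr>)" "unital_cstar_algebra (B\<lparr>carrier := V n\<rparr>)" for n
    using U V by (auto simp: AF_sequence_def unital_cstar_subalgebra_def)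
  have iso_U: "nrm B (f b) = nrm A b" if "b \<in> U n" for b n
    using star_iso_nrm[OF sub(3,4) star_iso_subalgebra[OF f sub(1) UV]] that by simp
  have iso: "nrm B (f a) = nrm A a" if a: "a \<in> carrier A" for a
  proof (rule antisym)
    show "nrm B (f a) \<le> nrm A a" by (rule unital_star_hom_contractive[OF cA cB hom a])
    show "nrm A a \<le> nrm B (f a)"
    proof (rule field_le_epsilon)
      fix e :: real assume "e > 0"
      \<comment> \<open>An error of e / 2 is spent twice: on replacing a by b in \<open>A\<close>,
        and on returning from f b to f a in \<open>B\<close>.\<close>
      then have "e / 2 > 0" by simp
      then obtain n b where b: "b \<in> U n" "b \<in> carrier A" "nrm A (a \<ominus>\<^bsub>A\<^esub> b) < e / 2"
        by (rule AF_sequence_dense[OF U a])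
      have "nrm A a \<le> nrm A (a \<ominus>\<^bsub>A\<^esub> b) + nrm A b"
        using A.nrm_add[of "a \<ominus>\<^bsub>A\<^esub> b" b] a b by (simp add: A.minus_add_cancel)
      moreover have "nrm B (f b) \<le> nrm B (f (b \<ominus>\<^bsub>A\<^esub> a)) + nrm B (f a)"
        using B.nrm_add[of "f b \<ominus>\<^bsub>B\<^esub> f a" "f a"] a b h
        by (simp add: B.minus_add_cancel unital_star_hom_minus[OF cA cB hom])
      moreover have "nrm B (f (b \<ominus>\<^bsub>A\<^esub> a)) \<le> nrm A (a \<ominus>\<^bsub>A\<^esub> b)"
        using unital_star_hom_contractive[OF cA cB hom, of "b \<ominus>\<^bsub>A\<^esub> a"] a b
        by (simp add: A.nrm_minus_commute)
      ultimately show "nrm A a \<le> nrm B (f a) + e" using iso_U[OF b(1)] b(3) by simp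
    qed
  qed
  have "y \<in> f ` carrier A" if y: "y \<in> carrier B" for y
  proof -
    have "\<exists>a\<in>carrier A. nrm B (y \<ominus>\<^bsub>B\<^esub> f a) < inverse (Suc k)" for k
    proof -
      have "inverse (real (Suc k)) > 0" by simp
      then obtain n b where "b \<in> V n" "nrm B (y \<ominus>\<^bsub>B\<^esub> b) < inverse (Suc k)"
        by (rule AF_sequence_dense[OF V y])
      then show ?thesis using UV[of n] sub(1)[of n] by (metis imageE subsetD)
    qed
    then obtain a where a: "\<And>k. a k \<in> carrier A" "\<And>k. nrm B (y \<ominus>\<^bsub>B\<^esub> f (a k)) < inverse (Suc k)"
      by metis
    have lim: "B.tends (\<lambda>k. f (a k)) y"
    proof (rule B.tendsI)
      show "nrm B (f (a k) \<ominus>\<^bsub>B\<^esub> y) \<le> inverse (Suc k)" for k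
        using a y h by (simp add: B.nrm_minus_commute less_imp_le)
    qed (use a y h LIMSEQ_inverse_real_of_nat in auto)
    \<comment> \<open>Since f is isometric, convergence of the images makes the preimages Cauchy;
      uniqueness of limits then identifies y with f l.\<close>
    have "\<exists>l. A.tends a l"
    proof (rule A.Cauchy_tends)
      fix e :: real assume "e > 0"
      then have "\<forall>\<^sub>F k in sequentially. nrm B (f (a k) \<ominus>\<^bsub>B\<^esub> y) < e / 2"
        using lim unfolding B.tends_def by (intro order_tendstoD) auto
      then obtain N where N: "nrm B (f (a k) \<ominus>\<^bsub>B\<^esub> y) < e / 2" if "k \<ge> N" for k
        by (auto simp: eventually_sequentially)
      have "nrm A (a m \<ominus>\<^bsub>A\<^esub> a n) < e" if "m \<ge> N" "n \<ge> N" for m n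
      proof -
        have "nrm A (a m \<ominus>\<^bsub>A\<^esub> a n) = nrm B (f (a m) \<ominus>\<^bsub>B\<^esub> f (a n))"
          using iso[of "a m \<ominus>\<^bsub>A\<^esub> a n"] a by (simp add: unital_star_hom_minus[OF cA cB hom])
        also have "\<dots> \<le> nrm B (f (a m) \<ominus>\<^bsub>B\<^esub> y) + nrm B (f (a n) \<ominus>\<^bsub>B\<^esub> y)"
          using B.nrm_triangle[of "f (a m)" y "f (a n)"] a y h by (simp add: B.nrm_minus_commute)
        also have "\<dots> < e" using N[OF that(1)] N[OF that(2)] by simp
        finally show ?thesis .
      qed
      then show "\<exists>N. \<forall>m\<ge>N. \<forall>n\<ge>N. nrm A (a m \<ominus>\<^bsub>A\<^esub> a n) < e" by blast
    qed (use a in auto)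
    then obtain l where l: "A.tends a l" ..
    have "B.tends (\<lambda>k. f (a k)) (f l)"
    proof (rule B.tendsI)
      show "nrm B (f (a k) \<ominus>\<^bsub>B\<^esub> f l) \<le> nrm A (a k \<ominus>\<^bsub>A\<^esub> l)" for k
        using iso[of "a k \<ominus>\<^bsub>A\<^esub> l"] l by (simp add: A.tends_def unital_star_hom_minus[OF cA cB hom])
    qed (use l h in \<open>auto simp: A.tends_def\<close>)
    then show ?thesis using B.tends_unique[OF lim] l by (auto simp: A.tends_def)
  qed
  then have "f ` carrier A = carrier B" using h by auto
  then show ?thesis using hom inj by (simp add: star_iso_def bij_betw_def)
qed

section \<open>The inner product of a faithful trace\<close>

text \<open>For q > p > 0 the powers of q / p are unbounded, also along the exponents 2 ^ k. These
  are the exponents reached by repeated squaring, as in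
  \<open>nrm_le_left_mult_bound\<close>.\<close>

lemma le_of_two_power_bound:
  fixes p q C :: real
  assumes "0 \<le> p" "0 \<le> q" and le: "\<And>k::nat. q ^ (2 ^ k) \<le> C * p ^ (2 ^ k)"
  shows "q \<le> p"
proof (rule ccontr)
  assume "\<not> q \<le> p"
  then have "q > p" by simp
  show False
  proof (cases "p = 0")
    case True
    then show False using le[of 0] \<open>q > p\<close> by simp
  next
    case False
    then have p: "p > 0" using assms by simp
    define r where "r = q / p"
    have r: "r > 1" using \<open>q > p\<close> p by (simp add: r_def)
    have bd: "r ^ (2 ^ k) \<le> C" for k
      using le[of k] p by (simp add: r_def power_divide field_simps)
    obtain n where "r ^ n > C" using real_arch_pow[OF r] by blast
    moreover have "r ^ n \<le> r ^ (2 ^ n)" using r by (intro power_increasing) auto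
    ultimately show False using bd[of n] by simp
  qed
qed

locale traced_cstar_algebra = unital_cstar_algebra A for A :: "'a cstar_algebra" (structure) +
  fixes \<mu> :: "'a \<Rightarrow> complex"
  assumes faithful_trace: "faithful_tracial_state A \<mu>"
begin

lemma \<mu>_add: "x \<in> carrier A \<Longrightarrow> y \<in> carrier A \<Longrightarrow> \<mu> (x \<oplus> y) = \<mu> x + \<mu> y"
  and \<mu>_smult: "x \<in> carrier A \<Longrightarrow> \<mu> (c \<odot> x) = c * \<mu> x"
  and \<mu>_commute: "x \<in> carrier A \<Longrightarrow> y \<in> carrier A \<Longrightarrow> \<mu> (x \<otimes> y) = \<mu> (y \<otimes> x)"
  and \<mu>_faithful: "x \<in> carrier A \<Longrightarrow> \<mu> (star A x \<otimes> x) = 0 \<Longrightarrow> x = \<zero>"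
  and \<mu>_bound: "x \<in> carrier A \<Longrightarrow> cmod (\<mu> x) \<le> nrm A x"
  and \<mu>_positive: "x \<in> carrier A \<Longrightarrow> \<mu> (star A x \<otimes> x) \<in> \<real> \<and> 0 \<le> Re (\<mu> (star A x \<otimes> x))"
  using faithful_trace unfolding faithful_tracial_state_def states_def positive_elements_def by auto

text \<open>The GNS inner product of the trace, antilinear in the first argument;
  \<open>nrm2\<close> is its norm.\<close>

definition ip :: "'a \<Rightarrow> 'a \<Rightarrow> complex" where
  "ip x y = \<mu> (star A x \<otimes> y)"

definition nrm2 :: "'a \<Rightarrow> real" where
  "nrm2 x = sqrt (Re (ip x x))"

lemma ip_add_right: "x \<in> carrier A \<Longrightarrow> y \<in> carrier A \<Longrightarrow> z \<in> carrier A \<Longrightarrow> ip x (y \<oplus> z) = ip x y + ip x z"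
  and ip_add_left: "x \<in> carrier A \<Longrightarrow> y \<in> carrier A \<Longrightarrow> z \<in> carrier A \<Longrightarrow> ip (x \<oplus> y) z = ip x z + ip y z"
  and ip_smult_right: "x \<in> carrier A \<Longrightarrow> y \<in> carrier A \<Longrightarrow> ip x (c \<odot> y) = c * ip x y"
  and ip_smult_left: "x \<in> carrier A \<Longrightarrow> y \<in> carrier A \<Longrightarrow> ip (c \<odot> x) y = cnj c * ip x y"
  by (simp_all add: ip_def \<mu>_add \<mu>_smult star_closed star_add star_smult r_distr l_distr
      smult_mult_left smult_mult_right)

lemmas ip_linear = ip_add_right ip_add_left ip_smult_right ip_smult_left

lemma ip_minus_right:
  "x \<in> carrier A \<Longrightarrow> y \<in> carrier A \<Longrightarrow> z \<in> carrier A \<Longrightarrow> ip x (y \<ominus> z) = ip x y - ip x z"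
  by (simp add: minus_eq_smult ip_linear)

lemma ip_zero_right [simp]: "x \<in> carrier A \<Longrightarrow> ip x \<zero> = 0"
  using ip_smult_right[of x \<zero> 0] by simp

lemma ip_self: "x \<in> carrier A \<Longrightarrow> ip x x = complex_of_real ((nrm2 x)\<^sup>2)"
  using \<mu>_positive[of x] by (simp add: ip_def nrm2_def of_real_Re)

lemma nrm2_nonneg: "x \<in> carrier A \<Longrightarrow> 0 \<le> nrm2 x"
  using \<mu>_positive[of x] by (simp add: ip_def nrm2_def)

lemma ip_self_eq_zero: "x \<in> carrier A \<Longrightarrow> ip x x = 0 \<Longrightarrow> x = \<zero>"
  using \<mu>_faithful by (simp add: ip_def)

lemma nrm2_eq_zero: "x \<in> carrier A \<Longrightarrow> nrm2 x = 0 \<Longrightarrow> x = \<zero>"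
  using ip_self_eq_zero ip_self by simp

text \<open>Hermitian symmetry comes from positivity: \<open>ip v v\<close> is real for v = x + c y,
  and the choices c = 1 and c = i settle the imaginary and the real part.\<close>

lemma ip_cnj:
  assumes x: "x \<in> carrier A" and y: "y \<in> carrier A" shows "ip y x = cnj (ip x y)"
proof -
  have im: "Im (c * ip x y + cnj c * ip y x) = 0" for c
  proof -
    have z: "x \<oplus> c \<odot> y \<in> carrier A" using x y by simp
    have "ip (x \<oplus> c \<odot> y) (x \<oplus> c \<odot> y)
        = ip x x + (c * ip x y + cnj c * ip y x) + cnj c * c * ip y y"
      using x y by (simp add: ip_linear algebra_simps)
    moreover have "Im (ip (x \<oplus> c \<odot> y) (x \<oplus> c \<odot> y)) = 0" using ip_self[OF z] by simp
    ultimately show ?thesis using ip_self[OF x] ip_self[OF y] by (simp add: mult.commute)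
  qed
  show ?thesis using im[of 1] im[of \<i>] by (simp add: complex_eq_iff)
qed

lemma Cauchy_Schwarz:
  assumes x: "x \<in> carrier A" and y: "y \<in> carrier A"
  shows "cmod (ip x y) \<le> nrm2 x * nrm2 y"
proof (cases "nrm2 y = 0")
  case True
  then show ?thesis using nrm2_eq_zero[OF y] x by simp
next
  case False
  define t where "t = (nrm2 y)\<^sup>2"
  have t: "t > 0" using False by (simp add: t_def)
  \<comment> \<open>This choice makes x + c y the component of x orthogonal to y.\<close>
  define c where "c = - ip y x / t"
  define z where "z = x \<oplus> c \<odot> y"
  have z: "z \<in> carrier A" using x y by (simp add: z_def)
  have yy: "ip y y = complex_of_real t" using ip_self[OF y] by (simp add: t_def)
  have "ip z z = ip x x + c * cnj (ip y x) + cnj c * ip y x + cnj c * c * t"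
    using x y yy ip_cnj[OF y x] by (simp add: z_def ip_linear algebra_simps)
  also have "\<dots> = complex_of_real ((nrm2 x)\<^sup>2 - (cmod (ip y x))\<^sup>2 / t)"
    using t ip_self[OF x] by (simp add: c_def field_simps complex_norm_square[symmetric] power2_eq_square)
  finally have "(cmod (ip y x))\<^sup>2 / t \<le> (nrm2 x)\<^sup>2"
    using ip_self[OF z] by (metis diff_ge_0_iff_ge of_real_eq_iff zero_le_power2)
  then have "(cmod (ip y x))\<^sup>2 \<le> (nrm2 x * nrm2 y)\<^sup>2" using t by (simp add: t_def field_simps)
  then have "cmod (ip y x) \<le> nrm2 x * nrm2 y"
    using nrm2_nonneg[OF x] nrm2_nonneg[OF y] power2_le_imp_le mult_nonneg_nonneg by blast
  then show ?thesis using ip_cnj[OF x y] by simp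
qed

lemma ip_mult_left_adjoint:
  "a \<in> carrier A \<Longrightarrow> x \<in> carrier A \<Longrightarrow> y \<in> carrier A \<Longrightarrow> ip x (a \<otimes> y) = ip (star A a \<otimes> x) y"
  by (simp add: ip_def star_mult star_star star_closed m_assoc)

text \<open>By traciality the involution is antiunitary; \<open>star_P\<close> rests on
  this.\<close>

lemma ip_star_star:
  assumes "x \<in> carrier A" "y \<in> carrier A"
  shows "ip (star A x) (star A y) = ip y x"
  using assms by (simp add: ip_def star_star \<mu>_commute star_closed)

text \<open>This is contractivity of the GNS representation. For a contraction b, a root s of 1 - b*
  b gives |y|^2 - |b y|^2 = |s y|^2 in the norm \<open>nrm2\<close>; the general case follows by
  scaling.\<close>

lemma nrm2_mult_le:
  assumes a: "a \<in> carrier A" and y: "y \<in> carrier A"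
  shows "nrm2 (a \<otimes> y) \<le> nrm A a * nrm2 y"
proof -
  have unit: "nrm2 (b \<otimes> y) \<le> nrm2 y" if b: "b \<in> carrier A" "nrm A b \<le> 1" for b
  proof -
    have bb: "star A b \<otimes> b \<in> carrier A" "star A (star A b \<otimes> b) = star A b \<otimes> b"
      using b by (auto simp: star_closed star_mult star_star)
    have "nrm A (star A b \<otimes> b) \<le> 1"
      using b nrm_star_mult[OF b(1)] nrm_nonneg[OF b(1)] by (simp add: power_le_one)
    from exists_sqrt[OF bb this] obtain s
      where s: "s \<in> carrier A" "star A s = s" "s \<otimes> s = \<one> \<ominus> star A b \<otimes> b" .
    have "ip (s \<otimes> y) (s \<otimes> y) = ip y ((s \<otimes> s) \<otimes> y)"
      using s(1,2) y ip_mult_left_adjoint[of s y "s \<otimes> y"] by (simp add: m_assoc)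
    also have "\<dots> = ip y y - ip y (star A b \<otimes> (b \<otimes> y))"
      unfolding s(3) using b y by (simp add: mult_minus_distrib ip_minus_right m_assoc star_closed)
    also have "ip y (star A b \<otimes> (b \<otimes> y)) = ip (b \<otimes> y) (b \<otimes> y)"
      using b y by (subst ip_mult_left_adjoint) (auto simp: star_closed star_star)
    finally have "complex_of_real ((nrm2 (s \<otimes> y))\<^sup>2)
        = complex_of_real ((nrm2 y)\<^sup>2 - (nrm2 (b \<otimes> y))\<^sup>2)"
      using s b y by (simp add: ip_self)
    then have "(nrm2 (b \<otimes> y))\<^sup>2 \<le> (nrm2 y)\<^sup>2"
      by (metis diff_ge_0_iff_ge of_real_eq_iff zero_le_power2)
    then show ?thesis using nrm2_nonneg[OF y] power2_le_imp_le by blast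
  qed
  have nrm2_smult: "nrm2 (complex_of_real t \<odot> x) = t * nrm2 x" if "t \<ge> 0" "x \<in> carrier A" for t x
    using that by (simp add: nrm2_def ip_linear real_sqrt_mult)
  show ?thesis
  proof (cases "nrm A a = 0")
    case True
    then have "a = \<zero>" using a nrm_eq_zero_iff by simp
    then show ?thesis using y by (simp add: nrm2_def)
  next
    case False
    then have pos: "nrm A a > 0" using nrm_nonneg[OF a] by simp
    have "nrm2 ((complex_of_real (1 / nrm A a) \<odot> a) \<otimes> y) \<le> nrm2 y"
      using a pos by (intro unit) (auto simp: nrm_smult norm_divide)
    then have "(1 / nrm A a) * nrm2 (a \<otimes> y) \<le> nrm2 y"
      using a y pos nrm2_smult[of "1 / nrm A a" "a \<otimes> y"] by (simp add: smult_mult_left)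
    then show ?thesis using pos by (simp add: field_simps)
  qed
qed

text \<open>Orthogonality is tested only against the range of \<open>P\<close>, which may be smaller
  than \<open>S\<close> while the projection is built up vector by vector. The last clause records
  what finite dimension gives: on the range, the C*-norm is bounded by a multiple of
  \<open>nrm2\<close>.\<close>

definition orthogonal_projection :: "'a set \<Rightarrow> ('a \<Rightarrow> 'a) \<Rightarrow> bool" where
  "orthogonal_projection S P \<longleftrightarrow>
     (\<forall>a\<in>carrier A. P a \<in> S) \<and>
     (\<forall>a\<in>carrier A. \<forall>b\<in>carrier A. P (a \<oplus> b) = P a \<oplus> P b) \<and>
     (\<forall>c. \<forall>a\<in>carrier A. P (c \<odot> a) = c \<odot> P a) \<and>
     (\<forall>a\<in>carrier A. \<forall>b\<in>carrier A. ip (P b) (P a) = ip (P b) a) \<and>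
     (\<exists>K. \<forall>a\<in>carrier A. nrm A (P a) \<le> K * nrm2 a)"

end

section \<open>Orthogonal projections into a subalgebra\<close>

locale traced_cstar_subalgebra = traced_cstar_algebra A \<mu> for A :: "'a cstar_algebra" (structure) and \<mu> +
  fixes S :: "'a set"
  assumes sub: "unital_cstar_subalgebra S A"
begin

sublocale S: unital_cstar_algebra "A\<lparr>carrier := S\<rparr>"
  using sub by (simp add: unital_cstar_subalgebra_def)

lemma S_carrier: "x \<in> S \<Longrightarrow> x \<in> carrier A"
  using sub by (auto simp: unital_cstar_subalgebra_def)

lemma S_closed:
  "x \<in> S \<Longrightarrow> y \<in> S \<Longrightarrow> x \<oplus> y \<in> S" "x \<in> S \<Longrightarrow> y \<in> S \<Longrightarrow> x \<otimes> y \<in> S"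
  "x \<in> S \<Longrightarrow> c \<odot> x \<in> S" "x \<in> S \<Longrightarrow> star A x \<in> S" "\<one> \<in> S" "\<zero> \<in> S"
  using S.a_closed[of x y] S.m_closed[of x y] S.smult_closed[of x c] S.star_closed[of x]
    S.one_closed S.zero_closed by auto

lemma S_minus_closed: "x \<in> S \<Longrightarrow> y \<in> S \<Longrightarrow> x \<ominus> y \<in> S"
  using S_closed S_carrier by (simp add: minus_eq_smult)

text \<open>Testing with b = (x - y)* gives \<open>ip (x \<ominus> y) (x \<ominus> y) = 0\<close>,
  and the trace is faithful. Identities for projections and expectations are derived through this
  principle.\<close>

lemma S_eqI:
  assumes xy: "x \<in> S" "y \<in> S" and eq: "\<And>b. b \<in> S \<Longrightarrow> \<mu> (b \<otimes> x) = \<mu> (b \<otimes> y)"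
  shows "x = y"
proof -
  note c = xy[THEN S_carrier]
  have "\<mu> (star A (x \<ominus> y) \<otimes> x) = \<mu> (star A (x \<ominus> y) \<otimes> y)"
    using xy by (intro eq S_closed S_minus_closed)
  then have "ip (x \<ominus> y) (x \<ominus> y) = 0" using c by (simp add: ip_minus_right) (simp add: ip_def)
  then have "x \<ominus> y = \<zero>" using c by (intro ip_self_eq_zero) auto
  then show ?thesis using c by (simp add: r_right_minus_eq)
qed

text \<open>One Gram-Schmidt step per spanning vector.\<close>

lemma exists_projection_fixing:
  assumes "finite F" "F \<subseteq> S"
  shows "\<exists>P. orthogonal_projection S P \<and> (\<forall>x\<in>F. P x = x)"
  using assms
proof (induction F rule: finite_induct)
  case empty
  have "orthogonal_projection S (\<lambda>_. \<zero>)"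
    unfolding orthogonal_projection_def
    by (auto simp: S_closed ip_def intro!: exI[of _ 0])
  then show ?case by blast
next
  case (insert g F)
  then obtain P where P: "orthogonal_projection S P" and PF: "\<And>x. x \<in> F \<Longrightarrow> P x = x" by auto
  then obtain K where
    P_S: "\<And>a. a \<in> carrier A \<Longrightarrow> P a \<in> S" and
    P_add: "\<And>a b. a \<in> carrier A \<Longrightarrow> b \<in> carrier A \<Longrightarrow> P (a \<oplus> b) = P a \<oplus> P b" and
    P_smult: "\<And>c a. a \<in> carrier A \<Longrightarrow> P (c \<odot> a) = c \<odot> P a" and
    P_ip: "\<And>a b. a \<in> carrier A \<Longrightarrow> b \<in> carrier A \<Longrightarrow> ip (P b) (P a) = ip (P b) a" and
    P_bound: "\<And>a. a \<in> carrier A \<Longrightarrow> nrm A (P a) \<le> K * nrm2 a"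
    unfolding orthogonal_projection_def by blast
  have P_c [simp]: "P a \<in> carrier A" if "a \<in> carrier A" for a using that P_S S_carrier by blast
  have g: "g \<in> S" "g \<in> carrier A" using insert S_carrier by auto
  define g' where "g' = g \<ominus> P g"
  have g': "g' \<in> S" "g' \<in> carrier A" using g P_S S_minus_closed S_carrier by (auto simp: g'_def)
  have orth: "ip (P a) g' = 0" if "a \<in> carrier A" for a
    using that g P_ip by (simp add: g'_def ip_minus_right)
  show ?case
  proof (cases "nrm2 g' = 0")
    case True
    \<comment> \<open>Here g is already fixed by \<open>P\<close>, so \<open>P\<close> itself
      serves.\<close>
    then have "g' = \<zero>" using g' nrm2_eq_zero by simp
    then have "P g = g" using g by (simp add: g'_def r_right_minus_eq)
    then show ?thesis using P PF by auto
  next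
    case False
    define t where "t = nrm2 g'"
    define e where "e = complex_of_real (1 / t) \<odot> g'"
    have t: "t > 0" using False nrm2_nonneg[OF g'(2)] by (simp add: t_def)
    have e: "e \<in> S" "e \<in> carrier A" using g' S_closed by (auto simp: e_def)
    have "ip e e = complex_of_real (1 / t) * (complex_of_real (1 / t) * ip g' g')"
      using g' by (simp add: e_def ip_linear)
    then have ee: "ip e e = 1" using g' t by (simp add: ip_self t_def power2_eq_square)
    have n2e: "nrm2 e = 1" using ee by (simp add: nrm2_def)
    have Pe: "ip (P a) e = 0" if "a \<in> carrier A" for a
      using that g' orth by (simp add: e_def ip_linear)
    have eP: "ip e (P a) = 0" if "a \<in> carrier A" for a
      using that e Pe ip_cnj[of "P a" e] by simp
    define Q where "Q a = P a \<oplus> ip e a \<odot> e" for a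
    have "orthogonal_projection S Q"
      unfolding orthogonal_projection_def
    proof (intro conjI ballI allI exI)
      fix a assume a: "a \<in> carrier A"
      show "Q a \<in> S" using a P_S e S_closed by (simp add: Q_def)
      show "Q (c \<odot> a) = c \<odot> Q a" for c
        using a e by (simp add: Q_def P_smult ip_linear smult_smult smult_add_right)
      \<comment> \<open>The new term contributes nrm A e to the constant: since e is a unit vector,
        Cauchy-Schwarz bounds its coefficient by \<open>nrm2 a\<close>.\<close>
      show "nrm A (Q a) \<le> (K + nrm A e) * nrm2 a"
      proof -
        have "nrm A (Q a) \<le> nrm A (P a) + cmod (ip e a) * nrm A e"
          using a e nrm_add[of "P a" "ip e a \<odot> e"] by (simp add: Q_def nrm_smult)
        also have "\<dots> \<le> K * nrm2 a + nrm2 a * nrm A e"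
          using P_bound[OF a] Cauchy_Schwarz[OF e(2) a] n2e nrm_nonneg[OF e(2)]
          by (intro add_mono mult_right_mono) auto
        finally show ?thesis by (simp add: algebra_simps)
      qed
      fix b assume b: "b \<in> carrier A"
      show "Q (a \<oplus> b) = Q a \<oplus> Q b"
        using a b e by (simp add: Q_def P_add ip_linear smult_add_left a_ac)
      show "ip (Q b) (Q a) = ip (Q b) a"
        using a b e Pe eP P_ip ee by (simp add: Q_def ip_linear)
    qed
    moreover have "Q x = x" if "x \<in> F" for x
    proof -
      have x: "x \<in> carrier A" using that insert S_carrier by auto
      then have "ip e x = 0" using eP[of x] PF[OF that] by simp
      then show ?thesis using x e PF[OF that] by (simp add: Q_def)
    qed
    moreover have "Q g = g"
    proof -
      have "g' \<oplus> P g = g" using g by (simp add: g'_def minus_add_cancel)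
      then have "ip e g = ip e g'" using eP[OF g(2)] ip_add_right[of e g' "P g"] e g g' by simp
      also have "\<dots> = t" using g' t by (simp add: e_def ip_linear ip_self t_def power2_eq_square)
      finally have "ip e g \<odot> e = g'" using g' t by (simp add: e_def smult_smult)
      then show ?thesis using \<open>g' \<oplus> P g = g\<close> g g' by (simp add: Q_def a_comm)
    qed
    ultimately show ?thesis by auto
  qed
qed

end

section \<open>Conditional expectations onto finite dimensional subalgebras\<close>

text \<open>Spanning is expressed through linear subspaces \<open>V\<close>, which avoids finite sums in its uses.\<close>

lemma (in unital_cstar_algebra) finite_spanning_set:
  assumes "finite_dimensional A"
  shows "\<exists>F. finite F \<and> F \<subseteq> carrier A \<and> (\<forall>V. F \<subseteq> V \<longrightarrow> \<zero> \<in> V \<longrightarrow>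
    (\<forall>x\<in>V \<inter> carrier A. \<forall>y\<in>V \<inter> carrier A. x \<oplus> y \<in> V) \<longrightarrow>
    (\<forall>c. \<forall>x\<in>V \<inter> carrier A. c \<odot> x \<in> V) \<longrightarrow> carrier A \<subseteq> V)"
proof -
  obtain F where F: "finite F" "F \<subseteq> carrier A"
    and span: "\<And>x. x \<in> carrier A \<Longrightarrow> \<exists>c. x = (\<Oplus>b\<in>F. c b \<odot> b)"
    using assms unfolding finite_dimensional_def by auto
  have "x \<in> V" if V: "F \<subseteq> V" "\<zero> \<in> V" "\<forall>x\<in>V \<inter> carrier A. \<forall>y\<in>V \<inter> carrier A. x \<oplus> y \<in> V"
    "\<forall>c. \<forall>x\<in>V \<inter> carrier A. c \<odot> x \<in> V" and x: "x \<in> carrier A" for V x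
  proof -
    have "(\<Oplus>b\<in>G. c b \<odot> b) \<in> V" if "G \<subseteq> F" for G c
      using finite_subset[OF that F(1)] that
    proof (induction G rule: finite_induct)
      case (insert g G)
      have cl: "(\<lambda>b. c b \<odot> b) \<in> G \<rightarrow> carrier A" "c g \<odot> g \<in> carrier A" using insert F by auto
      have "g \<in> V \<inter> carrier A" using insert F V(1) by auto
      then have "c g \<odot> g \<in> V" using V(4) by blast
      then show ?case using finsum_insert[OF insert(1,2) cl] finsum_closed[OF cl(1)] cl insert V(3) by auto
    qed (use V in simp)
    then show ?thesis using span[OF x] by blast
  qed
  then show ?thesis using F by (intro exI[of _ F]) blast
qed

text \<open>The fixed points of a linear map form a subspace, so it is enough to fix a finite
  spanning set.\<close>

lemma (in traced_cstar_subalgebra) exists_projection: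
  assumes fd: "finite_dimensional (A\<lparr>carrier := S\<rparr>)"
  obtains P where "orthogonal_projection S P" "\<And>x. x \<in> S \<Longrightarrow> P x = x"
proof -
  obtain F where F: "finite F" "F \<subseteq> S"
    and span: "\<And>V. F \<subseteq> V \<Longrightarrow> \<zero> \<in> V \<Longrightarrow> (\<forall>x\<in>V \<inter> S. \<forall>y\<in>V \<inter> S. x \<oplus> y \<in> V) \<Longrightarrow>
      (\<forall>c. \<forall>x\<in>V \<inter> S. c \<odot> x \<in> V) \<Longrightarrow> S \<subseteq> V"
    using S.finite_spanning_set[OF fd] by auto
  obtain P where P: "orthogonal_projection S P" and PF: "\<And>x. x \<in> F \<Longrightarrow> P x = x"
    using exists_projection_fixing[OF F] by blast
  have P_add: "\<And>a b. a \<in> carrier A \<Longrightarrow> b \<in> carrier A \<Longrightarrow> P (a \<oplus> b) = P a \<oplus> P b" and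
    P_smult: "\<And>c a. a \<in> carrier A \<Longrightarrow> P (c \<odot> a) = c \<odot> P a"
    using P unfolding orthogonal_projection_def by auto
  have "P \<zero> = \<zero>" using P_smult[of \<zero> 0] P S_carrier unfolding orthogonal_projection_def by auto
  then have "S \<subseteq> {x. P x = x}"
    using PF S_carrier by (intro span) (auto simp: P_add P_smult)
  then show thesis using that P by blast
qed

section \<open>The projection as a contractive, positive bimodule map\<close>

locale traced_cstar_projection = traced_cstar_subalgebra A \<mu> S
  for A :: "'a cstar_algebra" (structure) and \<mu> S +
  fixes P :: "'a \<Rightarrow> 'a"
  assumes projection: "orthogonal_projection S P" and P_fix: "x \<in> S \<Longrightarrow> P x = x"
begin

lemma P_S: "a \<in> carrier A \<Longrightarrow> P a \<in> S"
  and P_add: "a \<in> carrier A \<Longrightarrow> b \<in> carrier A \<Longrightarrow> P (a \<oplus> b) = P a \<oplus> P b"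
  and P_smult: "a \<in> carrier A \<Longrightarrow> P (c \<odot> a) = c \<odot> P a"
  using projection unfolding orthogonal_projection_def by auto

lemma P_closed [simp]: "a \<in> carrier A \<Longrightarrow> P a \<in> carrier A"
  using P_S S_carrier by blast

lemma ip_P: "b \<in> S \<Longrightarrow> a \<in> carrier A \<Longrightarrow> ip b (P a) = ip b a"
  using projection P_fix[of b] S_carrier[of b] unfolding orthogonal_projection_def by metis

lemma \<mu>_P: "b \<in> S \<Longrightarrow> a \<in> carrier A \<Longrightarrow> \<mu> (b \<otimes> P a) = \<mu> (b \<otimes> a)"
  using ip_P[of "star A b" a] S_closed(4) S_carrier by (simp add: ip_def star_star)

text \<open>Tested against y in \<open>S\<close>, the trace rotates c to the front: y b z c and (c y
  b) z have equal trace. As c y b lies in \<open>S\<close>, z = a may be exchanged with z = P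
  a.\<close>

lemma P_bimodule:
  assumes "b \<in> S" "c \<in> S" "a \<in> carrier A"
  shows "P (b \<otimes> a \<otimes> c) = b \<otimes> P a \<otimes> c"
proof (rule S_eqI)
  show "P (b \<otimes> a \<otimes> c) \<in> S" "b \<otimes> P a \<otimes> c \<in> S"
    using assms P_S S_closed S_carrier by auto
  fix y assume y: "y \<in> S"
  note cl = assms y assms(1,2)[THEN S_carrier] S_carrier[OF y]
  have rot: "\<mu> (y \<otimes> (b \<otimes> z \<otimes> c)) = \<mu> ((c \<otimes> y \<otimes> b) \<otimes> z)" if "z \<in> carrier A" for z
  proof -
    have "\<mu> (y \<otimes> (b \<otimes> z \<otimes> c)) = \<mu> ((y \<otimes> b \<otimes> z) \<otimes> c)" using cl that by (simp add: m_assoc)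
    also have "\<dots> = \<mu> (c \<otimes> (y \<otimes> b \<otimes> z))" using cl that by (intro \<mu>_commute) auto
    finally show ?thesis using cl that by (simp add: m_assoc)
  qed
  have "\<mu> (y \<otimes> P (b \<otimes> a \<otimes> c)) = \<mu> (y \<otimes> (b \<otimes> a \<otimes> c))" using cl by (intro \<mu>_P) auto
  also have "\<dots> = \<mu> ((c \<otimes> y \<otimes> b) \<otimes> P a)" using rot cl S_closed \<mu>_P[of "c \<otimes> y \<otimes> b" a] by simp
  also have "\<dots> = \<mu> (y \<otimes> (b \<otimes> P a \<otimes> c))" using rot cl by simp
  finally show "\<mu> (y \<otimes> P (b \<otimes> a \<otimes> c)) = \<mu> (y \<otimes> (b \<otimes> P a \<otimes> c))" .
qed

lemma P_mult_right: "a \<in> carrier A \<Longrightarrow> y \<in> S \<Longrightarrow> P (a \<otimes> y) = P a \<otimes> y"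
  using P_bimodule[of \<one> y a] S_closed(5) by simp

text \<open>The involution is antiunitary and preserves \<open>S\<close>, hence commutes with the
  projection onto \<open>S\<close>.\<close>

lemma star_P:
  assumes a: "a \<in> carrier A" shows "star A (P a) = P (star A a)"
proof (rule S_eqI)
  show "star A (P a) \<in> S" "P (star A a) \<in> S" using a P_S S_closed star_closed by auto
  fix b assume b: "b \<in> S"
  note cl = a star_closed[OF a] S_carrier[OF b] star_closed[OF S_carrier[OF b]]
  have "\<mu> (b \<otimes> star A (P a)) = ip (star A b) (star A (P a))" using cl by (simp add: ip_def star_star)
  also have "\<dots> = cnj (ip b (P a))" using cl ip_cnj[of b "P a"] by (simp add: ip_star_star)
  also have "\<dots> = cnj (ip b a)" using ip_P b cl by simp
  also have "\<dots> = ip (star A b) (star A a)" using cl ip_cnj[of b a] by (simp add: ip_star_star)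
  also have "\<dots> = \<mu> (b \<otimes> star A a)" using cl by (simp add: ip_def star_star)
  also have "\<dots> = \<mu> (b \<otimes> P (star A a))" using cl b by (simp add: \<mu>_P)
  finally show "\<mu> (b \<otimes> star A (P a)) = \<mu> (b \<otimes> P (star A a))" .
qed

lemma nrm2_P_le:
  assumes a: "a \<in> carrier A" shows "nrm2 (P a) \<le> nrm2 a"
proof -
  have "cmod (ip (P a) (P a)) \<le> nrm2 (P a) * nrm2 a"
    using ip_P[OF P_S[OF a] a] Cauchy_Schwarz[of "P a" a] a by simp
  then have "nrm2 (P a) * nrm2 (P a) \<le> nrm2 (P a) * nrm2 a"
    using a by (simp add: ip_self power2_eq_square norm_mult)
  then show ?thesis using nrm2_nonneg[of "P a"] nrm2_nonneg[of a] a
    by (cases "nrm2 (P a) = 0") auto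
qed

text \<open>The powers \<open>h ^ 2 ^ k\<close> of \<open>h = b* b\<close> have C*-norm \<open>(nrm b)\<^sup>2 ^ 2 ^ k\<close>, while on \<open>S\<close> the C*-norm is
  bounded by a multiple of \<open>nrm2\<close>; the bound follows by comparing growth rates.\<close>

lemma nrm_le_left_mult_bound:
  assumes b: "b \<in> S" and M: "0 \<le> M" and bM: "\<And>y. y \<in> S \<Longrightarrow> nrm2 (b \<otimes> y) \<le> M * nrm2 y"
  shows "nrm A b \<le> M"
proof -
  have bc: "b \<in> carrier A" "star A b \<in> S" "star A b \<in> carrier A"
    using b S_carrier S_closed by auto
  \<comment> \<open>The adjoint of left multiplication by b obeys the same bound, so b* b is bounded
    by M^2.\<close>
  have bsM: "nrm2 (star A b \<otimes> z) \<le> M * nrm2 z" if z: "z \<in> S" for z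
  proof -
    define w where "w = star A b \<otimes> z"
    have w: "w \<in> S" "w \<in> carrier A" "z \<in> carrier A" using bc z S_closed S_carrier by (auto simp: w_def)
    have "ip w w = ip (b \<otimes> w) z"
      using w bc ip_mult_left_adjoint[of "star A b" w z] by (simp add: w_def star_star)
    then have "cmod (ip w w) \<le> nrm2 (b \<otimes> w) * nrm2 z" using Cauchy_Schwarz[of "b \<otimes> w" z] w bc by simp
    also have "\<dots> \<le> M * nrm2 w * nrm2 z" using bM[OF w(1)] nrm2_nonneg w(3) by (intro mult_right_mono)
    finally have "nrm2 w * nrm2 w \<le> nrm2 w * (M * nrm2 z)"
      using w by (simp add: ip_self power2_eq_square norm_mult mult_ac)
    then have "nrm2 w \<le> M * nrm2 z"
      using nrm2_nonneg[OF w(2)] nrm2_nonneg[OF w(3)] M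
      by (cases "nrm2 w = 0") auto
    then show ?thesis by (simp add: w_def)
  qed
  define h where "h k = rec_nat (star A b \<otimes> b) (\<lambda>_ x. x \<otimes> x) k" for k
  have h_simps: "h 0 = star A b \<otimes> b" "h (Suc k) = h k \<otimes> h k" for k by (simp_all add: h_def)
  have h_S: "h k \<in> S" for k by (induction k) (use b bc S_closed in \<open>auto simp: h_simps\<close>)
  then have h_c: "h k \<in> carrier A" for k using S_carrier by blast
  have h_star: "star A (h k) = h k" for k
    by (induction k) (use bc h_c in \<open>auto simp: h_simps star_mult star_star\<close>)
  have h_nrm: "nrm A (h k) = ((nrm A b)\<^sup>2) ^ (2 ^ k)" for k
  proof (induction k)
    case 0 then show ?case using nrm_star_mult[OF bc(1)] by (simp add: h_simps)
  next
    case (Suc k)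
    then show ?case using nrm_star_mult[OF h_c[of k]]
      by (simp add: h_simps h_star power_mult[symmetric] mult_ac)
  qed
  have h_nrm2: "nrm2 (h k \<otimes> y) \<le> (M\<^sup>2) ^ (2 ^ k) * nrm2 y" if "y \<in> S" for k y
    using that
  proof (induction k arbitrary: y)
    case 0
    have "nrm2 (star A b \<otimes> (b \<otimes> y)) \<le> M * (M * nrm2 y)"
      using bsM[of "b \<otimes> y"] mult_left_mono[OF bM[OF 0] M] b 0 S_closed by force
    then show ?case using bc S_carrier[OF 0] by (simp add: h_simps m_assoc power2_eq_square mult_ac)
  next
    case (Suc k)
    have "nrm2 (h k \<otimes> (h k \<otimes> y)) \<le> (M\<^sup>2) ^ (2 ^ k) * nrm2 (h k \<otimes> y)"
      using Suc h_S S_closed by auto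
    also have "\<dots> \<le> (M\<^sup>2) ^ (2 ^ k) * ((M\<^sup>2) ^ (2 ^ k) * nrm2 y)"
      using Suc by (intro mult_left_mono) auto
    also have "\<dots> = (M\<^sup>2) ^ (2 ^ Suc k) * nrm2 y" by (simp add: power_add[symmetric] mult_2)
    finally show ?case using h_c S_carrier[OF Suc.prems] by (simp add: h_simps m_assoc)
  qed
  obtain K where K: "\<And>a. a \<in> carrier A \<Longrightarrow> nrm A (P a) \<le> K * nrm2 a"
    using projection unfolding orthogonal_projection_def by blast
  \<comment> \<open>The element h k is recovered by applying left multiplication to y = 1. The
    absolute value is taken because the sign of K is unknown.\<close>
  have "((nrm A b)\<^sup>2) ^ (2 ^ k) \<le> (\<bar>K\<bar> * nrm2 \<one>) * (M\<^sup>2) ^ (2 ^ k)" for k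
  proof -
    have "((nrm A b)\<^sup>2) ^ (2 ^ k) \<le> K * nrm2 (h k)"
      using K[OF h_c[of k]] P_fix[OF h_S] h_nrm by simp
    also have "\<dots> \<le> \<bar>K\<bar> * nrm2 (h k)" using nrm2_nonneg[OF h_c] by (intro mult_right_mono) auto
    also have "\<dots> \<le> \<bar>K\<bar> * ((M\<^sup>2) ^ (2 ^ k) * nrm2 \<one>)"
      using h_nrm2[OF S_closed(5), of k] h_c by (intro mult_left_mono) auto
    finally show ?thesis by (simp add: mult_ac)
  qed
  from le_of_two_power_bound[OF _ _ this] have "(nrm A b)\<^sup>2 \<le> M\<^sup>2" by simp
  then show ?thesis using M power2_le_imp_le by blast
qed

text \<open>For y in \<open>S\<close>, P(a) y = P(a y), so left multiplication by P a on
  \<open>S\<close> is the compression of left multiplication by a. It is therefore bounded by nrm a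
  for \<open>nrm2\<close>, and the preceding lemma turns this into a bound for the C*-norm.\<close>

lemma P_contractive:
  assumes a: "a \<in> carrier A" shows "nrm A (P a) \<le> nrm A a"
proof (rule nrm_le_left_mult_bound)
  fix y assume y: "y \<in> S"
  have "nrm2 (P a \<otimes> y) \<le> nrm2 (a \<otimes> y)" using nrm2_P_le[of "a \<otimes> y"] a y S_carrier by (simp add: P_mult_right)
  also have "\<dots> \<le> nrm A a * nrm2 y" using a y S_carrier by (intro nrm2_mult_le)
  finally show "nrm2 (P a \<otimes> y) \<le> nrm A a * nrm2 y" .
qed (use a P_S nrm_nonneg in auto)

text \<open>If \<open>0 \<le> h \<le> 1\<close> as a form on \<open>(S, ip)\<close>, then \<open>k = 1 - h\<close> satisfies
  \<open>k - k\<^sup>2 = k h k + h k h \<ge> 0\<close>, hence has norm at most 1, and \<open>h = 1 - k\<close> has a square root in \<open>S\<close>.\<close>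

lemma form_positive_imp_positive:
  assumes h: "h \<in> S" "star A h = h"
    and form: "\<And>y. y \<in> S \<Longrightarrow> ip y (h \<otimes> y) \<in> \<real> \<and> 0 \<le> Re (ip y (h \<otimes> y)) \<and> Re (ip y (h \<otimes> y)) \<le> (nrm2 y)\<^sup>2"
  shows "h \<in> positive_elements (A\<lparr>carrier := S\<rparr>)"
proof -
  have hc: "h \<in> carrier A" using h S_carrier by blast
  define k where "k = \<one> \<ominus> h"
  have k: "k \<in> S" "k \<in> carrier A" "star A k = k"
    using h hc S_minus_closed S_closed by (auto simp: k_def minus_eq_smult star_add star_smult)
  have form_k: "Re (ip y (k \<otimes> y)) = (nrm2 y)\<^sup>2 - Re (ip y (h \<otimes> y))" if "y \<in> S" for y
    using S_carrier[OF that] hc by (simp add: k_def mult_minus_distrib ip_minus_right ip_self)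
  have "nrm2 (k \<otimes> y) \<le> 1 * nrm2 y" if y: "y \<in> S" for y
  proof -
    have yc: "y \<in> carrier A" using y S_carrier by blast
    have hk: "h \<otimes> y = y \<ominus> k \<otimes> y"
      unfolding k_def mult_minus_distrib(2)[OF one_closed hc yc]
      using yc hc by (simp add: a_minus_def minus_add r_neg2)
    have hkk: "h \<otimes> (k \<otimes> y) = k \<otimes> (h \<otimes> y)" using yc hc by (simp add: k_def vec_simps)
    \<comment> \<open>This is k h k + h k h = k h as forms, which follows from k + h = 1 and h k = k
      h.\<close>
    have "ip (k \<otimes> y) (h \<otimes> (k \<otimes> y)) + ip (h \<otimes> y) (k \<otimes> (h \<otimes> y)) = ip (k \<otimes> y) (h \<otimes> y)"
    proof -
      have "ip (k \<otimes> y) (h \<otimes> (k \<otimes> y)) = ip (k \<otimes> y) (k \<otimes> (h \<otimes> y))" by (simp add: hkk)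
      moreover have "k \<otimes> y \<oplus> h \<otimes> y = y" 
        unfolding hk using yc k minus_add_cancel[of y "k \<otimes> y"] a_comm[of "k \<otimes> y" "y \<ominus> k \<otimes> y"] by simp
      then have "ip (k \<otimes> y) (k \<otimes> (h \<otimes> y)) + ip (h \<otimes> y) (k \<otimes> (h \<otimes> y)) = ip y (k \<otimes> (h \<otimes> y))"
        using yc hc k ip_add_left[of "k \<otimes> y" "h \<otimes> y" "k \<otimes> (h \<otimes> y)"] by simp
      ultimately show ?thesis using yc hc k by (simp add: ip_mult_left_adjoint)
    qed
    moreover have "0 \<le> Re (ip (k \<otimes> y) (h \<otimes> (k \<otimes> y)))" using form k y S_closed by simp
    \<comment> \<open>The upper bound on the form of h, taken at the vector h y, says that the form
      of k = 1 - h is nonnegative there.\<close>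
    moreover have "0 \<le> Re (ip (h \<otimes> y) (k \<otimes> (h \<otimes> y)))"
      using form[of "h \<otimes> y"] form_k[of "h \<otimes> y"] h y S_closed by simp
    ultimately have "0 \<le> Re (ip (k \<otimes> y) (h \<otimes> y))" by (metis add_nonneg_nonneg plus_complex.simps(1))
    moreover have "ip (k \<otimes> y) (h \<otimes> y) = ip (k \<otimes> y) y - ip (k \<otimes> y) (k \<otimes> y)"
      unfolding hk using yc k by (simp add: ip_minus_right)
    moreover have "ip (k \<otimes> y) y = ip y (k \<otimes> y)" using yc k by (simp add: ip_mult_left_adjoint)
    ultimately have "(nrm2 (k \<otimes> y))\<^sup>2 \<le> Re (ip y (k \<otimes> y))" using yc k by (simp add: ip_self)
    also have "\<dots> \<le> (nrm2 y)\<^sup>2" using form_k[OF y] form[OF y] by simp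
    finally show ?thesis using nrm2_nonneg[OF yc] power2_le_imp_le by auto
  qed
  then have "nrm A k \<le> 1" using nrm_le_left_mult_bound[of k 1] k by simp
  then have k': "k \<in> carrier (A\<lparr>carrier := S\<rparr>)" "star (A\<lparr>carrier := S\<rparr>) k = k"
    "nrm (A\<lparr>carrier := S\<rparr>) k \<le> 1" using k by auto
  \<comment> \<open>The root is taken inside the C*-algebra \<open>S\<close>, which keeps it in
    \<open>S\<close>.\<close>
  obtain s where s: "s \<in> S" "star A s = s" "s \<otimes> s = \<one> \<ominus>\<^bsub>A\<lparr>carrier := S\<rparr>\<^esub> k"
    by (rule S.exists_sqrt[OF k']) simp
  moreover have "\<one> \<ominus>\<^bsub>A\<lparr>carrier := S\<rparr>\<^esub> k = h"
    using hc k S_closed(5) minus_subalgebra[OF unital_cstar_algebra_axioms sub, of \<one> k]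
    by (simp add: k_def vec_simps smult_collect)
  ultimately show ?thesis unfolding positive_elements_def by (auto intro!: image_eqI[of _ _ s])
qed

text \<open>As a form on \<open>S\<close>, P(b* b) takes y to |b y|^2 in the norm
  \<open>nrm2\<close>. If b is a contraction, this lies between 0 and |y|^2, as
  \<open>form_positive_imp_positive\<close> demands.\<close>

lemma P_positive:
  assumes "p \<in> positive_elements A" shows "P p \<in> positive_elements (A\<lparr>carrier := S\<rparr>)"
proof -
  obtain a where a: "a \<in> carrier A" and p: "p = star A a \<otimes> a"
    using assms by (auto simp: positive_elements_def)
  have unit: "P (star A b \<otimes> b) \<in> positive_elements (A\<lparr>carrier := S\<rparr>)" if b: "b \<in> carrier A" "nrm A b \<le> 1" for b
  proof (rule form_positive_imp_positive)
    have bb: "star A b \<otimes> b \<in> carrier A" using b star_closed by simp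
    then show "P (star A b \<otimes> b) \<in> S" by (rule P_S)
    show "star A (P (star A b \<otimes> b)) = P (star A b \<otimes> b)"
      using bb b by (simp add: star_P star_mult star_star star_closed)
    fix y assume y: "y \<in> S"
    have yc: "y \<in> carrier A" using y S_carrier by blast
    have "ip y (P (star A b \<otimes> b) \<otimes> y) = ip y (star A b \<otimes> b \<otimes> y)"
      using bb y yc ip_P[OF y, of "star A b \<otimes> b \<otimes> y"] by (simp add: P_mult_right)
    also have "\<dots> = ip (b \<otimes> y) (b \<otimes> y)"
      using b yc ip_mult_left_adjoint[of "star A b" y "b \<otimes> y"] by (simp add: m_assoc star_closed star_star)
    finally have *: "ip y (P (star A b \<otimes> b) \<otimes> y) = complex_of_real ((nrm2 (b \<otimes> y))\<^sup>2)"
      using b yc by (simp add: ip_self)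
    have "nrm2 (b \<otimes> y) \<le> nrm2 y"
      using nrm2_mult_le[OF b(1) yc] mult_right_mono[OF b(2) nrm2_nonneg[OF yc]] by simp
    then show "ip y (P (star A b \<otimes> b) \<otimes> y) \<in> \<real> \<and> 0 \<le> Re (ip y (P (star A b \<otimes> b) \<otimes> y)) \<and>
      Re (ip y (P (star A b \<otimes> b) \<otimes> y)) \<le> (nrm2 y)\<^sup>2"
      unfolding * using nrm2_nonneg[of "b \<otimes> y"] b yc by (auto intro: power_mono)
  qed
  \<comment> \<open>The maximum with 1 keeps the division meaningful for a = 0.\<close>
  define t where "t = max 1 (nrm A a)"
  have t: "t \<ge> 1" "nrm A a \<le> t" by (auto simp: t_def)
  define b where "b = complex_of_real (1 / t) \<odot> a"
  have b: "b \<in> carrier A" "nrm A b \<le> 1" using a t by (auto simp: b_def nrm_smult norm_divide)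
  obtain s where s: "s \<in> S" "P (star A b \<otimes> b) = star A s \<otimes> s"
    using unit[OF b] by (auto simp: positive_elements_def)
  have "p = complex_of_real (t * t) \<odot> (star A b \<otimes> b)"
    using a t by (simp add: p b_def star_smult star_closed smult_mult_left smult_mult_right smult_smult)
  then have "P p = complex_of_real (t * t) \<odot> (star A s \<otimes> s)" using b s star_closed by (simp add: P_smult)
  also have "\<dots> = star A (complex_of_real t \<odot> s) \<otimes> (complex_of_real t \<odot> s)"
    using S_carrier[OF s(1)] by (simp add: star_smult star_closed smult_mult_left smult_mult_right smult_smult)
  finally show ?thesis using s(1) S_closed(3) unfolding positive_elements_def by (auto intro: image_eqI)
qed

lemma conditional_expectation_P: "conditional_expectation A S (restrict P (carrier A))"
  unfolding conditional_expectation_def linear_on_def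
proof (intro conjI ballI allI)
  show "restrict P (carrier A) p \<in> positive_elements (A\<lparr>carrier := S\<rparr>)" if "p \<in> positive_elements A" for p
  proof -
    have "p \<in> carrier A" using that star_closed by (auto simp: positive_elements_def)
    then show ?thesis using P_positive[OF that] by simp
  qed
qed (use P_S S_carrier in \<open>auto simp: P_add P_smult P_fix P_contractive P_bimodule\<close>)

end

section \<open>Identification of \<open>cond_exp\<close>\<close>

context traced_cstar_subalgebra begin

text \<open>Existence is witnessed by the restricted projection. For uniqueness, any competitor E
  satisfies mu (b E(x)) = mu (E(b x)) = mu (b x) for b in \<open>S\<close>. By \<open>S_eqI\<close>
  the two conclusions determine the value at a.\<close>

lemma cond_exp_characterization:
  assumes fd: "finite_dimensional (A\<lparr>carrier := S\<rparr>)" and a: "a \<in> carrier A"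
  shows "cond_exp A \<mu> S a \<in> S" "\<And>b. b \<in> S \<Longrightarrow> \<mu> (b \<otimes> cond_exp A \<mu> S a) = \<mu> (b \<otimes> a)"
proof -
  obtain P where P: "orthogonal_projection S P" "\<And>x. x \<in> S \<Longrightarrow> P x = x"
    using exists_projection[OF fd] by blast
  interpret traced_cstar_projection A \<mu> S P by standard (use P in auto)
  let ?Q = "\<lambda>E. conditional_expectation A S E \<and> (\<forall>a\<in>carrier A. \<mu> (E a) = \<mu> a)"
  have Q: "?Q (restrict P (carrier A))"
    using conditional_expectation_P \<mu>_P[OF S_closed(5)] by simp
  have "E = restrict P (carrier A)" if E: "?Q E" for E
  proof (rule extensionalityI)
    show "E \<in> extensional (carrier A)" "restrict P (carrier A) \<in> extensional (carrier A)"
      using E by (auto simp: conditional_expectation_def)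
    fix x assume x: "x \<in> carrier A"
    have Ex: "E x \<in> S" using E x by (auto simp: conditional_expectation_def linear_on_def)
    have "E x = P x"
    proof (rule S_eqI)
      show "E x \<in> S" "P x \<in> S" using Ex P_S x by auto
      fix b assume b: "b \<in> S"
      have "E (b \<otimes> x \<otimes> \<one>) = b \<otimes> E x \<otimes> \<one>"
        using E b x S_closed(5) unfolding conditional_expectation_def by blast
      then have "E (b \<otimes> x) = b \<otimes> E x" using b Ex x S_carrier by simp
      moreover have "\<mu> (E (b \<otimes> x)) = \<mu> (b \<otimes> x)" using E b x S_carrier by simp
      ultimately show "\<mu> (b \<otimes> E x) = \<mu> (b \<otimes> P x)" using \<mu>_P b x by simp
    qed
    then show "E x = restrict P (carrier A) x" using x by simp
  qed
  then have "cond_exp A \<mu> S = restrict P (carrier A)"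
    unfolding cond_exp_def using Q by (intro the_equality) auto
  then show "cond_exp A \<mu> S a \<in> S" "\<And>b. b \<in> S \<Longrightarrow> \<mu> (b \<otimes> cond_exp A \<mu> S a) = \<mu> (b \<otimes> a)"
    using a P_S \<mu>_P by auto
qed

end

section \<open>Transport of structure and the propinquity\<close>

text \<open>An isomorphic copy on another type; the algebra of a bridge has to live on
  \<open>universe\<close>, while \<open>A\<close> lives on an arbitrary type.\<close>

definition transport :: "'a cstar_algebra \<Rightarrow> ('a \<Rightarrow> 'c) \<Rightarrow> 'c cstar_algebra" where
  "transport A f = (let g = inv_into (carrier A) f in
     \<lparr>carrier = f ` carrier A,
      monoid.mult = (\<lambda>x y. f (g x \<otimes>\<^bsub>A\<^esub> g y)),
      one = f \<one>\<^bsub>A\<^esub>,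
      ring.zero = f \<zero>\<^bsub>A\<^esub>,
      add = (\<lambda>x y. f (g x \<oplus>\<^bsub>A\<^esub> g y)),
      smult = (\<lambda>c x. f (c \<odot>\<^bsub>A\<^esub> g x)),
      star = (\<lambda>x. f (star A (g x))),
      nrm = (\<lambda>x. nrm A (g x))\<rparr>)"

lemma transport_simps:
  assumes "inj_on f (carrier A)"
  shows "carrier (transport A f) = f ` carrier A"
    "\<one>\<^bsub>transport A f\<^esub> = f \<one>\<^bsub>A\<^esub>" "\<zero>\<^bsub>transport A f\<^esub> = f \<zero>\<^bsub>A\<^esub>"
    "\<lbrakk>x \<in> carrier A; y \<in> carrier A\<rbrakk> \<Longrightarrow> f x \<otimes>\<^bsub>transport A f\<^esub> f y = f (x \<otimes>\<^bsub>A\<^esub> y)"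
    "\<lbrakk>x \<in> carrier A; y \<in> carrier A\<rbrakk> \<Longrightarrow> f x \<oplus>\<^bsub>transport A f\<^esub> f y = f (x \<oplus>\<^bsub>A\<^esub> y)"
    "x \<in> carrier A \<Longrightarrow> c \<odot>\<^bsub>transport A f\<^esub> f x = f (c \<odot>\<^bsub>A\<^esub> x)"
    "x \<in> carrier A \<Longrightarrow> star (transport A f) (f x) = f (star A x)"
    "x \<in> carrier A \<Longrightarrow> nrm (transport A f) (f x) = nrm A x"
  using assms by (simp_all add: transport_def Let_def)

lemma unital_cstar_algebra_transport:
  assumes A: "unital_cstar_algebra A" and inj: "inj_on f (carrier A)"
  shows "unital_cstar_algebra (transport A f)"
proof -
  interpret A: unital_cstar_algebra A by fact
  define D where "D = transport A f"
  note t = transport_simps[OF inj, folded D_def]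
  note inj_iff = inj_on_eq_iff[OF inj]
  have group: "abelian_group D"
  proof (rule abelian_groupI)
    fix x assume "x \<in> carrier D"
    then obtain a where a: "a \<in> carrier A" "x = f a" by (auto simp: t)
    have "f (\<ominus>\<^bsub>A\<^esub> a) \<oplus>\<^bsub>D\<^esub> x = \<zero>\<^bsub>D\<^esub>" using a by (simp add: t A.l_neg)
    moreover have "f (\<ominus>\<^bsub>A\<^esub> a) \<in> carrier D" using a by (simp add: t)
    ultimately show "\<exists>y\<in>carrier D. y \<oplus>\<^bsub>D\<^esub> x = \<zero>\<^bsub>D\<^esub>" by blast
  qed (auto simp: t A.a_assoc, simp add: A.a_comm)
  have monoid: "monoid D"
    by (rule monoidI) (auto simp: t A.m_assoc)
  have ring: "ring D"
    using group monoid by (rule ringI) (auto simp: t A.l_distr A.r_distr)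
  have module: "module ring_of_type_algebra D"
    by (rule moduleI[OF cring_from_type_algebra group])
      (auto simp: t ring_of_type_algebra_def A.smult_add_left A.smult_add_right A.smult_smult)
  interpret D: ring D by (rule ring)
  \<comment> \<open>Negation is not a field of the record, so it has to be computed from the
    transported addition.\<close>
  have minus: "f x \<ominus>\<^bsub>D\<^esub> f y = f (x \<ominus>\<^bsub>A\<^esub> y)" if xy: "x \<in> carrier A" "y \<in> carrier A" for x y
  proof -
    have "f (\<ominus>\<^bsub>A\<^esub> y) \<oplus>\<^bsub>D\<^esub> f y = \<zero>\<^bsub>D\<^esub>" using xy by (simp add: t A.l_neg)
    then have "\<ominus>\<^bsub>D\<^esub> f y = f (\<ominus>\<^bsub>A\<^esub> y)" using xy by (intro D.minus_equality) (auto simp: t)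
    then show ?thesis using xy by (simp add: a_minus_def t)
  qed
  have dist: "nrm_dist D (f x) (f y) = nrm_dist A x y" if "x \<in> carrier A" "y \<in> carrier A" for x y
    using that by (simp add: nrm_dist_def t minus)
  interpret MA: Metric_space "carrier A" "nrm_dist A" by (rule A.Metric_space_nrm)
  \<comment> \<open>The metric axioms are checked directly: \<open>Metric_space_nrm\<close>
    presupposes that \<open>D\<close> is a C*-algebra, including the completeness still to be
    shown.\<close>
  interpret MD: Metric_space "carrier D" "nrm_dist D"
  proof
    fix x y z
    show "0 \<le> nrm_dist D x y"
      using MA.nonneg by (auto simp: t dist nrm_dist_def[of D x y] minus A.nrm_nonneg)
    show "nrm_dist D x y = nrm_dist D y x"
      by (auto simp: t dist nrm_dist_def[of D] minus A.nrm_minus_commute)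
    assume xy: "x \<in> carrier D" "y \<in> carrier D"
    then show "nrm_dist D x y = 0 \<longleftrightarrow> x = y" by (auto simp: t dist inj_iff)
    assume "z \<in> carrier D"
    with xy show "nrm_dist D x z \<le> nrm_dist D x y + nrm_dist D y z"
      by (auto simp: t dist intro: MA.triangle)
  qed
  have complete: "MD.mcomplete"
    unfolding MD.mcomplete_def
  proof (intro allI impI)
    fix \<sigma> assume \<sigma>: "MD.MCauchy \<sigma>"
    define s where "s n = inv_into (carrier A) f (\<sigma> n)" for n
    have \<sigma>_D: "\<sigma> n \<in> carrier D" for n using \<sigma> unfolding MD.MCauchy_def by blast
    then have s: "s n \<in> carrier A" "f (s n) = \<sigma> n" for n
      by (simp_all add: s_def t inv_into_into f_inv_into_f)
    have "\<exists>l. A.tends s l"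
    proof (rule A.Cauchy_tends[OF s(1)])
      fix e :: real assume "e > 0"
      then obtain N where "\<And>n m. N \<le> n \<Longrightarrow> N \<le> m \<Longrightarrow> nrm_dist D (\<sigma> n) (\<sigma> m) < e"
        using \<sigma> unfolding MD.MCauchy_def by blast
      then show "\<exists>N. \<forall>m\<ge>N. \<forall>n\<ge>N. nrm A (s m \<ominus>\<^bsub>A\<^esub> s n) < e"
        using s by (metis dist nrm_dist_def)
    qed
    then obtain l where l: "A.tends s l" ..
    have "limitin MD.mtopology \<sigma> (f l) sequentially"
      unfolding MD.limit_metric_sequentially
    proof (intro conjI allI impI)
      have lc: "l \<in> carrier A" using l by (simp add: A.tends_def)
      then show "f l \<in> carrier D" by (simp add: t)
      fix e :: real assume "e > 0"
      then have "\<forall>\<^sub>F n in sequentially. nrm A (s n \<ominus>\<^bsub>A\<^esub> l) < e"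
        using l unfolding A.tends_def by (intro order_tendstoD) auto
      then obtain N where N: "\<And>n. n \<ge> N \<Longrightarrow> nrm A (s n \<ominus>\<^bsub>A\<^esub> l) < e"
        by (auto simp: eventually_sequentially)
      have "\<sigma> n \<in> carrier D \<and> nrm_dist D (\<sigma> n) (f l) < e" if "n \<ge> N" for n
        using N[OF that] dist[OF s(1)[of n] lc] s[of n] lc \<sigma>_D[of n] by (auto simp: nrm_dist_def[of A])
      then show "\<exists>N. \<forall>n\<ge>N. \<sigma> n \<in> carrier D \<and> nrm_dist D (\<sigma> n) (f l) < e" by blast
    qed
    then show "\<exists>x. limitin MD.mtopology \<sigma> x sequentially" by blast
  qed
  have "unital_cstar_algebra D"
    using ring module
  proof (rule unital_cstar_algebra.intro)
    show "unital_cstar_algebra_axioms D"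
      by (unfold_locales)
        (use complete in \<open>auto simp: t A.smult_mult_left A.smult_mult_right A.star_closed A.star_star A.star_add
          A.star_smult A.star_mult A.nrm_nonneg A.nrm_eq_zero_iff A.nrm_smult A.nrm_add A.nrm_mult
          A.nrm_star_mult inj_iff\<close>)
  qed
  then show ?thesis by (simp add: D_def)
qed

lemma star_iso_transport:
  assumes "unital_cstar_algebra A" and inj: "inj_on f (carrier A)"
  shows "star_iso A (transport A f) f"
proof -
  interpret A: unital_cstar_algebra A by fact
  note t = transport_simps[OF inj]
  have "f \<in> ring_hom A (transport A f)" by (rule ring_hom_memI) (auto simp: t)
  then show ?thesis using inj
    by (auto simp: star_iso_def unital_star_hom_def linear_on_def t bij_betw_def)
qed

lemma star_iso_comp:
  assumes f: "star_iso A B f" and g: "star_iso B C g"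
  shows "star_iso A C (g \<circ> f)"
proof -
  have hom: "unital_star_hom A B f" "unital_star_hom B C g"
    using f g by (auto simp: star_iso_def)
  note h = unital_star_homD[OF hom(1)] unital_star_homD[OF hom(2)]
  have "g \<circ> f \<in> ring_hom A C" by (rule ring_hom_memI) (auto simp: h)
  then show ?thesis using f g
    by (auto simp: star_iso_def unital_star_hom_def linear_on_def h intro: bij_betw_trans)
qed

section \<open>Pullback of states and bridges of length zero\<close>

lemma compose_states:
  assumes A: "unital_cstar_algebra A" and B: "unital_cstar_algebra B" and f: "unital_star_hom A B f"
    and \<theta>: "\<theta> \<in> states B"
  shows "compose (carrier A) \<theta> f \<in> states A"
proof -
  interpret A: unital_cstar_algebra A by fact
  note h = unital_star_homD[OF f]
  have s: "\<And>x y. x \<in> carrier B \<Longrightarrow> y \<in> carrier B \<Longrightarrow> \<theta> (x \<oplus>\<^bsub>B\<^esub> y) = \<theta> x + \<theta> y"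
    "\<And>c x. x \<in> carrier B \<Longrightarrow> \<theta> (c \<odot>\<^bsub>B\<^esub> x) = c * \<theta> x"
    "\<And>x. x \<in> carrier B \<Longrightarrow> \<theta> (star B x \<otimes>\<^bsub>B\<^esub> x) \<in> \<real> \<and> 0 \<le> Re (\<theta> (star B x \<otimes>\<^bsub>B\<^esub> x))"
    "\<And>x. x \<in> carrier B \<Longrightarrow> cmod (\<theta> x) \<le> nrm B x" "\<theta> \<one>\<^bsub>B\<^esub> = 1"
    using \<theta> by (auto simp: states_def positive_elements_def)
  have "cmod (\<theta> (f x)) \<le> nrm A x" if "x \<in> carrier A" for x
    using s(4)[of "f x"] unital_star_hom_contractive[OF A B f that] h(1)[OF that] by simp
  then show ?thesis
    by (auto simp: states_def positive_elements_def compose_def h s A.star_closed)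
qed

text \<open>A state of \<open>A\<close> is the pullback of its composition with the inverse
  isomorphism. This makes the height of the bridge vanish: with pivot 1 the pullback sets are the
  full state spaces.\<close>

lemma star_iso_compose_states:
  assumes A: "unital_cstar_algebra A" and B: "unital_cstar_algebra B" and f: "star_iso A B f"
  shows "(\<lambda>\<theta>. compose (carrier A) \<theta> f) ` states B = states A"
proof
  show "(\<lambda>\<theta>. compose (carrier A) \<theta> f) ` states B \<subseteq> states A"
    using compose_states[OF A B] f by (auto simp: star_iso_def)
  show "states A \<subseteq> (\<lambda>\<theta>. compose (carrier A) \<theta> f) ` states B"
  proof
    fix \<psi> assume \<psi>: "\<psi> \<in> states A"
    define g where "g = inv_into (carrier A) f"
    have bij: "bij_betw f (carrier A) (carrier B)" using f by (simp add: star_iso_def)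
    have "compose (carrier B) \<psi> g \<in> states B"
      using compose_states[OF B A _ \<psi>] star_iso_inv_into[OF A f] by (simp add: star_iso_def g_def)
    moreover have "\<psi> = compose (carrier A) (compose (carrier B) \<psi> g) f"
    proof (rule extensionalityI)
      show "\<psi> \<in> extensional (carrier A)" using \<psi> by (simp add: states_def)
      show "\<psi> x = compose (carrier A) (compose (carrier B) \<psi> g) f x" if "x \<in> carrier A" for x
        using that bij by (auto simp: compose_def g_def bij_betw_inv_into_left dest: bij_betwE)
    qed auto
    ultimately show "\<psi> \<in> (\<lambda>\<theta>. compose (carrier A) \<theta> f) ` states B" by blast
  qed
qed

lemma one_level_states_one:
  assumes "unital_cstar_algebra D"
  shows "one_level_states D \<one>\<^bsub>D\<^esub> = states D"
proof -
  interpret D: unital_cstar_algebra D by fact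
  have "\<phi> \<zero>\<^bsub>D\<^esub> = 0" if "\<phi> \<in> states D" for \<phi>
  proof -
    have "\<phi> (0 \<odot>\<^bsub>D\<^esub> \<zero>\<^bsub>D\<^esub>) = 0 * \<phi> \<zero>\<^bsub>D\<^esub>" using that D.zero_closed unfolding states_def by blast
    then show ?thesis by simp
  qed
  then show ?thesis by (auto simp: one_level_states_def a_minus_def D.r_neg)
qed

lemma hausdorff_distance_eq_zero:
  assumes "\<And>x. x \<in> S \<Longrightarrow> \<exists>y\<in>T. d x y = 0" "\<And>y. y \<in> T \<Longrightarrow> \<exists>x\<in>S. d x y = 0"
  shows "hausdorff_distance d S T = 0"
proof -
  have "(INF y\<in>T. d x y) = 0" if "x \<in> S" for x
    using assms(1)[OF that] by (metis INF_lower le_zero_eq)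
  moreover have "(INF x\<in>S. d x y) = 0" if "y \<in> T" for y
    using assms(2)[OF that] by (metis INF_lower le_zero_eq)
  ultimately have "(SUP x\<in>S. INF y\<in>T. d x y) \<le> 0" "(SUP y\<in>T. INF x\<in>S. d x y) \<le> 0"
    by (intro SUP_least; simp)+
  then show ?thesis by (simp add: hausdorff_distance_def)
qed

lemma mk_dist_self: "mk_dist A L \<phi> \<phi> = 0"
proof -
  have "mk_dist A L \<phi> \<phi> \<le> 0" unfolding mk_dist_def by (rule SUP_least) simp
  then show ?thesis by simp
qed

lemma hausdorff_distance_mk_dist_self: "hausdorff_distance (mk_dist A L) S S = 0"
  by (rule hausdorff_distance_eq_zero) (auto intro!: mk_dist_self)

text \<open>Both algebras are mapped onto one copy of \<open>A\<close>, with a and its image under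
  the isometry going to the same element. Pairing them matches the two Lip-balls exactly, so the
  reach is 0. The hypothesis \<open>st\<close> provides the state that a bridge must have.\<close>

lemma quantum_isometry_propinquity_eq_zero:
  fixes f :: "'a \<Rightarrow> universe" and A :: "'a cstar_algebra" and B :: "'b cstar_algebra"
  assumes A: "unital_cstar_algebra A" and B: "unital_cstar_algebra B"
    and iso: "quantum_isometry (A, LA) (B, LB) \<phi>"
    and inj: "inj_on f (carrier A)" and st: "states A \<noteq> {}"
  shows "propinquity C D (A, LA) (B, LB) = 0"
proof -
  interpret A: unital_cstar_algebra A by fact
  interpret B: unital_cstar_algebra B by fact
  have \<phi>: "star_iso A B \<phi>" and L: "\<And>a. a \<in> self_adjoint A \<Longrightarrow> LB (\<phi> a) = LA a"
    using iso by (auto simp: quantum_isometry_def)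
  define E where "E = transport A f"
  define g where "g = inv_into (carrier A) \<phi>"
  have E: "unital_cstar_algebra E" using unital_cstar_algebra_transport[OF A inj] by (simp add: E_def)
  interpret E: unital_cstar_algebra E by (rule E)
  have f: "star_iso A E f" using star_iso_transport[OF A inj] by (simp add: E_def)
  have g: "star_iso B A g" using star_iso_inv_into[OF A \<phi>] by (simp add: g_def)
  have fg: "star_iso B E (f \<circ> g)" using g f by (rule star_iso_comp)
  have bij: "bij_betw \<phi> (carrier A) (carrier B)" using \<phi> by (simp add: star_iso_def)
  have g\<phi>: "g (\<phi> a) = a" if "a \<in> carrier A" for a
    using that bij by (simp add: g_def bij_betw_inv_into_left)
  have \<phi>g: "\<phi> (g b) = b" if "b \<in> carrier B" for b
    using that bij by (simp add: g_def bij_betw_inv_into_right)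
  note h\<phi> = unital_star_homD[of A B \<phi>] and hg = unital_star_homD[of B A g] and hf = unital_star_homD[of A E f]
  have homs: "unital_star_hom A B \<phi>" "unital_star_hom B A g" "unital_star_hom A E f"
    using \<phi> g f by (auto simp: star_iso_def)
  define \<gamma> where "\<gamma> = (E, f, f \<circ> g, \<one>\<^bsub>E\<^esub>)"
  have stE: "states E \<noteq> {}" using star_iso_compose_states[OF A E f] st by auto
  have "is_bridge A B \<gamma>"
    using E f fg stE by (auto simp: \<gamma>_def is_bridge_def one_level_states_one unital_star_mono_def star_iso_def bij_betw_def)
  moreover have "bridge_height (A, LA) (B, LB) \<gamma> = 0"
    using star_iso_compose_states[OF A E f] star_iso_compose_states[OF B E fg]
    by (simp add: \<gamma>_def bridge_height_def pullback_states_def one_level_states_one[OF E]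
        hausdorff_distance_mk_dist_self)
  moreover have "bridge_reach (A, LA) (B, LB) \<gamma> = 0"
  proof -
    have zero: "nrm E (f a \<otimes>\<^bsub>E\<^esub> \<one>\<^bsub>E\<^esub> \<ominus>\<^bsub>E\<^esub> \<one>\<^bsub>E\<^esub> \<otimes>\<^bsub>E\<^esub> f (g b)) = 0"
      if "a \<in> carrier A" "b \<in> carrier B" "g b = a" for a b
      using that hf(1)[OF homs(3)] by (simp add: E.r_right_minus_eq[THEN iffD2])
    have \<phi>_ball: "\<phi> a \<in> lip_ball B LB" if "a \<in> lip_ball A LA" for a
      using that L h\<phi>(1,6)[OF homs(1), of a] by (auto simp: lip_ball_def self_adjoint_def)
    have g_ball: "g b \<in> lip_ball A LA" if "b \<in> lip_ball B LB" for b
      using that L[of "g b"] hg(1,6)[OF homs(2), of b] \<phi>g[of b] by (auto simp: lip_ball_def self_adjoint_def)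
    have carrier: "lip_ball A LA \<subseteq> carrier A" "lip_ball B LB \<subseteq> carrier B"
      by (auto simp: lip_ball_def self_adjoint_def)
    show ?thesis
      unfolding \<gamma>_def bridge_reach_def prod.case comp_def
    proof (rule hausdorff_distance_eq_zero)
      fix a assume a: "a \<in> lip_ball A LA"
      then have "a \<in> carrier A" "\<phi> a \<in> carrier B" using carrier \<phi>_ball by auto
      then show "\<exists>b\<in>lip_ball B LB. ennreal (nrm E (f a \<otimes>\<^bsub>E\<^esub> \<one>\<^bsub>E\<^esub> \<ominus>\<^bsub>E\<^esub> \<one>\<^bsub>E\<^esub> \<otimes>\<^bsub>E\<^esub> f (g b))) = 0"
        using zero[of a "\<phi> a"] g\<phi> \<phi>_ball[OF a] by (intro bexI[of _ "\<phi> a"]) auto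
    next
      fix b assume b: "b \<in> lip_ball B LB"
      then have "b \<in> carrier B" "g b \<in> carrier A" using carrier g_ball by auto
      then show "\<exists>a\<in>lip_ball A LA. ennreal (nrm E (f a \<otimes>\<^bsub>E\<^esub> \<one>\<^bsub>E\<^esub> \<ominus>\<^bsub>E\<^esub> \<one>\<^bsub>E\<^esub> \<otimes>\<^bsub>E\<^esub> f (g b))) = 0"
        using zero[of "g b" b] g_ball[OF b] by (intro bexI[of _ "g b"]) auto
    qed
  qed
  ultimately have "bridge_length (A, LA) (B, LB) \<gamma> = 0" "is_bridge (fst (A, LA)) (fst (B, LB)) \<gamma>"
    by (simp_all add: bridge_length_def)
  then have "0 \<in> bridge_lengths (A, LA) (B, LB)"
    unfolding bridge_lengths_def by (metis (mono_tags, lifting) mem_Collect_eq)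
  then have "propinquity C D (A, LA) (B, LB) \<le> 0"
    unfolding propinquity_def by (intro Inf_lower) auto
  then show ?thesis by simp
qed

text \<open>An element is coded by its inner products with a countable set of dense span;
  faithfulness of the trace makes the code injective.\<close>

lemma AF_sequence_inj_universe:
  assumes U: "AF_sequence A U" and \<mu>: "faithful_tracial_state A \<mu>"
  obtains f :: "'a \<Rightarrow> universe" where "inj_on f (carrier A)"
proof -
  have A: "unital_cstar_algebra A" using U by (simp add: AF_sequence_def)
  interpret traced_cstar_algebra A \<mu>
    using A \<mu> by (intro traced_cstar_algebra.intro traced_cstar_algebra_axioms.intro)
  have sub: "unital_cstar_subalgebra (U n) A" for n using U by (simp add: AF_sequence_def)
  have Uc: "U n \<subseteq> carrier A" for n using sub[of n] by (simp add: unital_cstar_subalgebra_def)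
  have "\<exists>F. finite F \<and> F \<subseteq> U n \<and> (\<forall>V. F \<subseteq> V \<longrightarrow> \<zero>\<^bsub>A\<^esub> \<in> V \<longrightarrow>
      (\<forall>x\<in>V \<inter> U n. \<forall>y\<in>V \<inter> U n. x \<oplus>\<^bsub>A\<^esub> y \<in> V) \<longrightarrow> (\<forall>c. \<forall>x\<in>V \<inter> U n. c \<odot>\<^bsub>A\<^esub> x \<in> V) \<longrightarrow> U n \<subseteq> V)" for n
  proof -
    have *: "unital_cstar_algebra (A\<lparr>carrier := U n\<rparr>)" "finite_dimensional (A\<lparr>carrier := U n\<rparr>)"
      using U by (auto simp: AF_sequence_def unital_cstar_subalgebra_def)
    show ?thesis using unital_cstar_algebra.finite_spanning_set[OF *] by simp
  qed
  then obtain F where F: "\<And>n. finite (F n)" "\<And>n. F n \<subseteq> U n"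
    and span: "\<And>n V. F n \<subseteq> V \<Longrightarrow> \<zero>\<^bsub>A\<^esub> \<in> V \<Longrightarrow> (\<And>x y. x \<in> V \<inter> U n \<Longrightarrow> y \<in> V \<inter> U n \<Longrightarrow> x \<oplus>\<^bsub>A\<^esub> y \<in> V) \<Longrightarrow>
      (\<And>c x. x \<in> V \<inter> U n \<Longrightarrow> c \<odot>\<^bsub>A\<^esub> x \<in> V) \<Longrightarrow> U n \<subseteq> V"
    by metis
  \<comment> \<open>Inserting zero makes the set nonempty, hence the range of a sequence.\<close>
  define G where "G = insert \<zero>\<^bsub>A\<^esub> (\<Union>n. F n)"
  have "countable G" using F(1) by (auto simp: G_def intro: countable_finite)
  define e where "e = from_nat_into G"
  have e: "range e = G" unfolding e_def using \<open>countable G\<close> by (intro range_from_nat_into) (auto simp: G_def)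
  have ec: "e k \<in> carrier A" for k
  proof -
    have "e k \<in> G" using e by blast
    then show ?thesis using F(2) Uc by (auto simp: G_def)
  qed
  \<comment> \<open>Real and imaginary parts are interleaved at even and odd positions.\<close>
  define f :: "'a \<Rightarrow> universe" where
    "f x k = (if even k then Re (ip (e (k div 2)) x) else Im (ip (e (k div 2)) x))" for x k
  have "x = y" if xy: "x \<in> carrier A" "y \<in> carrier A" and eq: "f x = f y" for x y
  proof -
    define z where "z = x \<ominus>\<^bsub>A\<^esub> y"
    have z: "z \<in> carrier A" using xy by (simp add: z_def)
    have "ip (e k) z = 0" for k
    proof -
      have "ip (e k) x = ip (e k) y"
        using fun_cong[OF eq, of "2 * k"] fun_cong[OF eq, of "Suc (2 * k)"]
        by (simp add: f_def complex_eq_iff)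
      then show ?thesis using ec xy by (simp add: z_def ip_minus_right)
    qed
    then have G0: "ip b z = 0" if "b \<in> G" for b using that e by auto
    have U0: "ip b z = 0" if "b \<in> U n" for b n
    proof -
      have "U n \<subseteq> {b. ip b z = 0}"
      proof (rule span)
        show "F n \<subseteq> {b. ip b z = 0}" using G0 by (auto simp: G_def)
        show "\<zero>\<^bsub>A\<^esub> \<in> {b. ip b z = 0}" using G0 by (auto simp: G_def)
      qed (use z Uc in \<open>auto simp: ip_linear subset_iff\<close>)
      then show ?thesis using that by auto
    qed
    \<comment> \<open>The vector z is orthogonal to every \<open>U n\<close> and approximated by
      some b there, so <z, z> = <z - b, z> is small. The summand 1 in the tolerance avoids division
      by zero.\<close>
    have "cmod (ip z z) \<le> 0"
    proof (rule field_le_epsilon)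
      fix \<epsilon> :: real assume \<epsilon>: "\<epsilon> > 0"
      have N: "nrm A z + 1 > 0" using nrm_nonneg[OF z] by simp
      then have "\<epsilon> / (nrm A z + 1) > 0" using \<epsilon> by simp
      then obtain n b where b: "b \<in> U n" "b \<in> carrier A" "nrm A (z \<ominus>\<^bsub>A\<^esub> b) < \<epsilon> / (nrm A z + 1)"
        by (rule AF_sequence_dense[OF U z])
      have "ip z z = ip (z \<ominus>\<^bsub>A\<^esub> b) z"
        using z b U0[OF b(1)] by (simp add: minus_eq_smult ip_linear)
      then have "cmod (ip z z) \<le> nrm A (star A (z \<ominus>\<^bsub>A\<^esub> b) \<otimes>\<^bsub>A\<^esub> z)"
        using z b by (simp add: ip_def \<mu>_bound star_closed)
      also have "\<dots> \<le> nrm A (z \<ominus>\<^bsub>A\<^esub> b) * nrm A z"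
        using nrm_mult[of "star A (z \<ominus>\<^bsub>A\<^esub> b)" z] z b by (simp add: star_closed)
      also have "\<dots> \<le> (\<epsilon> / (nrm A z + 1)) * (nrm A z + 1)"
        using b nrm_nonneg[OF z] nrm_nonneg[of "z \<ominus>\<^bsub>A\<^esub> b"] z by (intro mult_mono) auto
      finally show "cmod (ip z z) \<le> 0 + \<epsilon>" using N by simp
    qed
    then have "z = \<zero>\<^bsub>A\<^esub>" using ip_self_eq_zero[OF z] by simp
    then show ?thesis using xy by (simp add: z_def r_right_minus_eq)
  qed
  then have "inj_on f (carrier A)" by (intro inj_onI)
  then show thesis by (rule that)
qed

text \<open>Provides a state on each \<open>U n\<close>, as the bridge between the finite
  dimensional algebras requires.\<close>

lemma restrict_state_subalgebra:
  assumes "unital_cstar_algebra A" "unital_cstar_subalgebra S A" "\<mu> \<in> states A"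
  shows "restrict \<mu> S \<in> states (A\<lparr>carrier := S\<rparr>)"
proof -
  interpret S: unital_cstar_algebra "A\<lparr>carrier := S\<rparr>"
    using assms(2) by (simp add: unital_cstar_subalgebra_def)
  have S: "S \<subseteq> carrier A" using assms(2) by (simp add: unital_cstar_subalgebra_def)
  have cl: "\<And>x y. x \<in> S \<Longrightarrow> y \<in> S \<Longrightarrow> x \<oplus>\<^bsub>A\<^esub> y \<in> S" "\<And>x y. x \<in> S \<Longrightarrow> y \<in> S \<Longrightarrow> x \<otimes>\<^bsub>A\<^esub> y \<in> S"
    "\<And>c x. x \<in> S \<Longrightarrow> c \<odot>\<^bsub>A\<^esub> x \<in> S" "\<And>x. x \<in> S \<Longrightarrow> star A x \<in> S" "\<one>\<^bsub>A\<^esub> \<in> S"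
    using S.a_closed S.m_closed S.smult_closed S.star_closed S.one_closed by auto
  show ?thesis
    using assms(3) S cl by (auto simp: states_def positive_elements_def subset_iff)
qed

text \<open>Every b in T is the image of some s in S, so pairings over T become pairings over S,
  where the characterization of the expectation applies.\<close>

lemma cond_exp_star_iso:
  assumes A: "traced_cstar_subalgebra A \<mu> S" and B: "traced_cstar_subalgebra B \<nu> T"
    and fdS: "finite_dimensional (A\<lparr>carrier := S\<rparr>)" and fdT: "finite_dimensional (B\<lparr>carrier := T\<rparr>)"
    and \<phi>: "unital_star_hom A B \<phi>" and ST: "\<phi> ` S = T"
    and \<mu>\<nu>: "\<And>a. a \<in> carrier A \<Longrightarrow> \<mu> a = \<nu> (\<phi> a)"
    and a: "a \<in> carrier A"
  shows "cond_exp B \<nu> T (\<phi> a) = \<phi> (cond_exp A \<mu> S a)"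
proof -
  interpret A: traced_cstar_subalgebra A \<mu> S by fact
  interpret B: traced_cstar_subalgebra B \<nu> T by fact
  note h = unital_star_homD[OF \<phi>]
  note cA = A.cond_exp_characterization[OF fdS a] and cB = B.cond_exp_characterization[OF fdT h(1)[OF a]]
  show ?thesis
  proof (rule B.S_eqI)
    show "cond_exp B \<nu> T (\<phi> a) \<in> T" by (rule cB)
    show "\<phi> (cond_exp A \<mu> S a) \<in> T" using cA(1) ST by blast
    fix b assume b: "b \<in> T"
    then obtain s where s: "s \<in> S" "b = \<phi> s" using ST by blast
    have c: "s \<in> carrier A" "cond_exp A \<mu> S a \<in> carrier A" using s cA(1) A.S_carrier by auto
    have "\<nu> (b \<otimes>\<^bsub>B\<^esub> cond_exp B \<nu> T (\<phi> a)) = \<nu> (\<phi> (s \<otimes>\<^bsub>A\<^esub> a))" using cB(2)[OF b] s c a h by simp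
    also have "\<dots> = \<nu> (\<phi> (s \<otimes>\<^bsub>A\<^esub> cond_exp A \<mu> S a))"
      using cA(2)[OF s(1)] c a by (simp flip: \<mu>\<nu>)
    also have "\<dots> = \<nu> (b \<otimes>\<^bsub>B\<^esub> \<phi> (cond_exp A \<mu> S a))" using s c h by simp
    finally show "\<nu> (b \<otimes>\<^bsub>B\<^esub> cond_exp B \<nu> T (\<phi> a)) = \<nu> (b \<otimes>\<^bsub>B\<^esub> \<phi> (cond_exp A \<mu> S a))" .
  qed
qed

theorem theorem5p3:
  fixes A :: "'a cstar_algebra" and B :: "'b cstar_algebra"
    and \<mu> :: "'a \<Rightarrow> complex" and \<nu> :: "'b \<Rightarrow> complex"
    and U :: "nat \<Rightarrow> 'a set" and V :: "nat \<Rightarrow> 'b set"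
    and \<beta> :: "nat \<Rightarrow> real" and \<phi> :: "'a \<Rightarrow> 'b"
  assumes "AF_sequence A U" and "U 0 = complex_scalars A"
    and "faithful_tracial_state A \<mu>"
    and "AF_sequence B V" and "V 0 = complex_scalars B"
    and "faithful_tracial_state B \<nu>"
    and "\<And>n. 0 < \<beta> n" and "\<beta> \<longlonglongrightarrow> 0"
    and "unital_star_mono A B \<phi>"
    and "\<And>n. \<phi> ` U n = V n"
    and "\<And>a. a \<in> carrier A \<Longrightarrow> \<mu> a = \<nu> (\<phi> a)"
  shows "quantum_isometry (A, AF_lip_norm A U \<mu> \<beta>) (B, AF_lip_norm B V \<nu> \<beta>) \<phi> \<and>
    propinquity 2 0 (A, AF_lip_norm A U \<mu> \<beta>) (B, AF_lip_norm B V \<nu> \<beta>) = 0 \<and>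
    (\<forall>n. propinquity 2 0 (A\<lparr>carrier := U n\<rparr>, AF_lip_norm A U \<mu> \<beta>)
                          (B\<lparr>carrier := V n\<rparr>, AF_lip_norm B V \<nu> \<beta>) = 0)"
proof -
  have cA: "unital_cstar_algebra A" and cB: "unital_cstar_algebra B"
    and subA: "\<And>n. unital_cstar_subalgebra (U n) A" and subB: "\<And>n. unital_cstar_subalgebra (V n) B"
    and fd: "\<And>n. finite_dimensional (A\<lparr>carrier := U n\<rparr>)" "\<And>n. finite_dimensional (B\<lparr>carrier := V n\<rparr>)"
    using assms(1,4) by (auto simp: AF_sequence_def)
  have UA: "U n \<subseteq> carrier A" for n using subA[of n] by (simp add: unital_cstar_subalgebra_def)
  have iso: "star_iso A B \<phi>" by (rule AF_sequence_star_iso[OF assms(1,4,9,10)])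
  then have hom: "unital_star_hom A B \<phi>" by (simp add: star_iso_def)
  have tA: "traced_cstar_subalgebra A \<mu> (U n)" for n
    using cA assms(3) subA
    by (intro traced_cstar_subalgebra.intro traced_cstar_algebra.intro
        traced_cstar_algebra_axioms.intro traced_cstar_subalgebra_axioms.intro)
  have tB: "traced_cstar_subalgebra B \<nu> (V n)" for n
    using cB assms(6) subB
    by (intro traced_cstar_subalgebra.intro traced_cstar_algebra.intro
        traced_cstar_algebra_axioms.intro traced_cstar_subalgebra_axioms.intro)
  have lip: "AF_lip_norm B V \<nu> \<beta> (\<phi> a) = AF_lip_norm A U \<mu> \<beta> a" if a: "a \<in> carrier A" for a
  proof -
    have "nrm B (\<phi> a \<ominus>\<^bsub>B\<^esub> cond_exp B \<nu> (V n) (\<phi> a)) = nrm A (a \<ominus>\<^bsub>A\<^esub> cond_exp A \<mu> (U n) a)" for n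
    proof -
      interpret A: traced_cstar_subalgebra A \<mu> "U n" by (rule tA)
      have c: "cond_exp A \<mu> (U n) a \<in> carrier A"
        using A.cond_exp_characterization(1)[OF fd(1) a] UA by blast
      have "\<phi> a \<ominus>\<^bsub>B\<^esub> cond_exp B \<nu> (V n) (\<phi> a) = \<phi> (a \<ominus>\<^bsub>A\<^esub> cond_exp A \<mu> (U n) a)"
        using cond_exp_star_iso[OF tA tB fd hom assms(10,11) a] unital_star_hom_minus[OF cA cB hom a c]
        by simp
      then show ?thesis using star_iso_nrm[OF cA cB iso] a c by simp
    qed
    then show ?thesis by (simp add: AF_lip_norm_def)
  qed
  obtain f :: "'a \<Rightarrow> universe" where f: "inj_on f (carrier A)"
    using AF_sequence_inj_universe[OF assms(1,3)] by blast
  have st: "\<mu> \<in> states A" using assms(3) by (simp add: faithful_tracial_state_def)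
  have isometry: "quantum_isometry (A, AF_lip_norm A U \<mu> \<beta>) (B, AF_lip_norm B V \<nu> \<beta>) \<phi>"
    using iso lip by (auto simp: quantum_isometry_def self_adjoint_def)
  moreover have "propinquity 2 0 (A, AF_lip_norm A U \<mu> \<beta>) (B, AF_lip_norm B V \<nu> \<beta>) = 0"
    using quantum_isometry_propinquity_eq_zero[OF cA cB isometry f] st by blast
  moreover have "propinquity 2 0 (A\<lparr>carrier := U n\<rparr>, AF_lip_norm A U \<mu> \<beta>)
      (B\<lparr>carrier := V n\<rparr>, AF_lip_norm B V \<nu> \<beta>) = 0" for n
  \<comment> \<open>The Lip-norm on \<open>U n\<close> is still formed with the expectations of the
    ambient algebra, so \<open>lip\<close> applies unchanged, and f restricts to an embedding of
    \<open>U n\<close>.\<close>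
  proof (rule quantum_isometry_propinquity_eq_zero)
    show "unital_cstar_algebra (A\<lparr>carrier := U n\<rparr>)" "unital_cstar_algebra (B\<lparr>carrier := V n\<rparr>)"
      using subA subB by (auto simp: unital_cstar_subalgebra_def)
    show "quantum_isometry (A\<lparr>carrier := U n\<rparr>, AF_lip_norm A U \<mu> \<beta>)
        (B\<lparr>carrier := V n\<rparr>, AF_lip_norm B V \<nu> \<beta>) \<phi>"
      using star_iso_subalgebra[OF assms(9) UA assms(10)] lip UA
      by (auto simp: quantum_isometry_def self_adjoint_def)
    show "inj_on f (carrier (A\<lparr>carrier := U n\<rparr>))" using f UA by (auto intro: inj_on_subset)
    show "states (A\<lparr>carrier := U n\<rparr>) \<noteq> {}" using restrict_state_subalgebra[OF cA subA st] by blast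
  qed
  ultimately show ?thesis by blast
qed

end
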